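(* For each real $z<1$ there is a unique real $\rho(z)\in(-1,\infty)$ with $\psi(1+\rho(z))-\psi(1)=z$; in fact $\rho(z)\in(-1,1)$. Let $\sigma^*=1+|s_1(\psi(2))|\approx1.457$, where $s_1(a)$ denotes the unique root in $(-1,0)$ of $\psi(s)=a$. Then for every real $z<1$ and $n\ge2$, \[ \mathbb{E}[e^{zD_n}]=\frac{-z\Gamma(-\rho(z))}{\psi'(1+\rho(z))}\cdot\frac{\Gamma(n)}{\Gamma(n-\rho(z))}+O\big(n^{-\sigma^*}\big) \] and \[ \mathbb{E}[e^{zD_n}]=\frac{-z\Gamma(-\rho(z))}{\psi'(1+\rho(z))}\,n^{\rho(z)}\Big(1+O\big(n^{-\min(1,\sigma^*+\rho(z))}\big)\Big), \] where for $z=0$ the factor $-z\Gamma(-\rho(z))$ is interpreted as its limit $\psi'(1)$. The first estimate holds uniformly for $z\le1-\delta$ for any $\delta>0$, and the second uniformly for $z$ in any compact subset of $(-\infty,1)$.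
   Context: $D_n$ is the absorption time at state 1 of the continuous-time Markov chain on $\{1,2,\dots\}$ started at $n$ that jumps from $m$ to $i$ at rate $1/(m-i)$ for $1\le i\le m-1$. $\psi=\Gamma'/\Gamma$ is the digamma function. For each real $a$, the equation $\psi(s)=a$ has exactly one root in each interval $(-i,-(i-1))$, $i\ge1$. *)

theory Defs
  imports "HOL-Analysis.Analysis" "HOL-Probability.Probability"
begin

text \<open>The continuous-time Markov chain on positive integers jumping from m to i
  (1 \<le> i < m) at rate 1/(m-i).  From state m \<ge> 2 the total jump rate is harm (m-1);
  the holding time is exponential with that rate, and the jump goes to i with
  probability (1/(m-i)) / harm (m-1), independently of the holding time.
  D_n is the absorption time at 1 started from n; its law is determined by the
  strong Markov property recursively: law(D_1) = point mass at 0, and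
  law(D_m) = mixture over i of (Exp(harm (m-1)) convolved with law(D_i)).\<close>

definition jump_prob :: "nat \<Rightarrow> nat \<Rightarrow> real" where
  "jump_prob m i = (if 1 \<le> i \<and> i < m then 1 / (real (m - i) * harm (m - 1)) else 0)"

definition expo :: "real \<Rightarrow> real measure" where
  "expo l = density lborel (exponential_density l)"

primrec D_laws :: "nat \<Rightarrow> real measure list" where
  "D_laws 0 = []"
| "D_laws (Suc k) = D_laws k @
     [if k = 0 then return borel 0
      else density (count_space UNIV) (\<lambda>i. ennreal (jump_prob (Suc k) i)) \<bind>
             (\<lambda>i. if 1 \<le> i \<and> i \<le> k then expo (harm k) \<star> (D_laws k ! (i - 1))
                  else return borel 0)]"

definition D_law :: "nat \<Rightarrow> real measure" where
  "D_law n = D_laws n ! (n - 1)"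

definition mgf_D :: "real \<Rightarrow> nat \<Rightarrow> real" where
  "mgf_D z n = (\<integral>x. exp (z * x) \<partial>D_law n)"

definition rho :: "real \<Rightarrow> real" where
  "rho z = (THE r. r > -1 \<and> Digamma (1 + r) - Digamma 1 = z)"

definition s1 :: "real \<Rightarrow> real" where
  "s1 a = (THE s. -1 < s \<and> s < 0 \<and> Digamma s = a)"

definition sigma_star :: real where
  "sigma_star = 1 + \<bar>s1 (Digamma 2)\<bar>"

text \<open>The constant -z Gamma(-rho z) / psi'(1 + rho z); at z = 0 the numerator is
  interpreted as its limit psi'(1).\<close>
definition Cz :: "real \<Rightarrow> real" where
  "Cz z = (if z = 0 then Polygamma 1 1 else - z * Gamma (- rho z)) / Polygamma 1 (1 + rho z)"

end

theory Submission
  imports Defs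
begin

text \<open>
  Conditioning on the first jump gives a recurrence for the moment generating function. The binomial
  coefficients \<open>N \<mapsto> N choose k\<close> are eigenfunctions of the generator (in the variable \<open>N = n - 1\<close>)
  with eigenvalue \<open>harm k\<close>, whence
  \<open>E exp (z D_n) = -z (\<Sum>k\<le>n-1. (-1)^k (n-1 choose k) / (\<Phi>(k) - z))\<close> with
  \<open>\<Phi>(s) = \<psi>(1+s) - \<psi>(1)\<close>, \<open>\<Phi>(k) = harm k\<close>.

  No contour integration is needed to expand this sum. Truncate the series of \<open>\<Phi>\<close> to the rational
  function \<open>\<Phi>\<^sub>M(s) = (\<Sum>m=1..M. 1/m - 1/(m+s))\<close> and replace \<open>z\<close> by \<open>\<Phi>\<^sub>M(\<rho>)\<close>, so that \<open>\<rho>\<close> stays a pole of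
  \<open>1 / (\<Phi>\<^sub>M - z)\<close>. All poles are real and simple with positive residues, and those other than \<open>\<rho>\<close> lie
  below \<open>-\<sigma>\<^sup>*\<close>. The \<open>N\<close>-th difference turns \<open>1/(s-r)\<close> into the beta value \<open>N! / pochhammer (-r) (N+1)\<close>:
  the pole \<open>\<rho>\<close> gives the main term. As \<open>(1+b) N! / pochhammer b (N+1)\<close> decreases in \<open>b\<close> and the sum of
  the \<open>c\<^sub>r/(1-r)\<close> is at most \<open>1/(\<Phi>\<^sub>M(1) - z)\<close> (evaluate the partial fractions at 1), the other poles
  together contribute \<open>O(n^(-\<sigma>\<^sup>*))\<close>. Finally \<open>M\<close> tends to infinity with \<open>n\<close> fixed.
\<close>

section \<open>The recurrence for the moment generating function\<close>

lemma harm_ge_1: "n \<ge> 1 \<Longrightarrow> harm n \<ge> (1::real)"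
  using harm_mono[of 1 n, where 'a = real] by (simp add: harm_def)

lemma length_D_laws [simp]: "length (D_laws n) = n"
  by (induction n) auto

text \<open>Appending leaves earlier entries alone, so the lists are prefixes of one sequence
  \<open>D_law\<close> and their recursion becomes a recursion for it.\<close>

lemma D_laws_nth: "j < n \<Longrightarrow> D_laws n ! j = D_law (Suc j)"
proof (induction n)
  case (Suc n)
  show ?case
  proof (cases "j = n")
    case False
    then show ?thesis using Suc by (simp add: nth_append)
  qed (simp add: D_law_def)
qed simp

lemma D_law_1: "D_law (Suc 0) = return borel 0"
  by (simp add: D_law_def)

lemma D_law_Suc:
  assumes "k \<ge> 1"
  shows "D_law (Suc k) = density (count_space UNIV) (\<lambda>i. ennreal (jump_prob (Suc k) i)) \<bind>
           (\<lambda>i. if 1 \<le> i \<and> i \<le> k then expo (harm k) \<star> D_law i else return borel 0)"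
proof -
  have "(if 1 \<le> i \<and> i \<le> k then expo (harm k) \<star> (D_laws k ! (i - 1)) else return borel 0)
      = (if 1 \<le> i \<and> i \<le> k then expo (harm k) \<star> D_law i else return borel 0)" for i
    by (auto simp: D_laws_nth)
  then show ?thesis using assms by (simp add: D_law_def nth_append)
qed

lemma sum_jump_prob:
  assumes "k \<ge> 1"
  shows "(\<Sum>i=1..k. jump_prob (Suc k) i) = 1"
proof -
  have "(\<Sum>i=1..k. jump_prob (Suc k) i) = (\<Sum>i=1..k. 1 / (real (Suc k - i) * harm k))"
    by (intro sum.cong) (auto simp: jump_prob_def)
  also have "\<dots> = (\<Sum>i=1..k. 1 / (real i * harm k))"
    by (rule sum.reindex_bij_witness[of _ "\<lambda>i. Suc k - i" "\<lambda>i. Suc k - i"]) auto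
  also have "\<dots> = (\<Sum>i=1..k. inverse (real i)) / harm k"
    by (simp add: sum_divide_distrib inverse_eq_divide)
  also have "\<dots> = harm k / harm k"
    by (simp only: harm_def)
  finally show ?thesis using harm_ge_1[OF assms] by simp
qed

lemma nn_integral_jump:
  "(\<integral>\<^sup>+i. f i \<partial>density (count_space UNIV) (\<lambda>i. ennreal (jump_prob (Suc k) i)))
     = (\<Sum>i=1..k. ennreal (jump_prob (Suc k) i) * f i)"
proof -
  have "(\<integral>\<^sup>+i. f i \<partial>density (count_space UNIV) (\<lambda>i. ennreal (jump_prob (Suc k) i)))
     = (\<integral>\<^sup>+i. ennreal (jump_prob (Suc k) i) * f i \<partial>count_space UNIV)"
    by (subst nn_integral_density) auto
  also have "\<dots> = (\<integral>\<^sup>+i. ennreal (jump_prob (Suc k) i) * f i \<partial>count_space {1..k})"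
    by (rule nn_integral_count_space_eq) (auto simp: jump_prob_def)
  finally show ?thesis by (simp add: nn_integral_count_space_finite)
qed

section \<open>Laws and transition kernels as probability measures\<close>

lemma prob_space_expo: "l > 0 \<Longrightarrow> prob_space (expo l)"
  unfolding expo_def by (rule prob_space_exponential_density)

lemma prob_space_convolution:
  fixes M N :: "real measure"
  assumes "prob_space M" "prob_space N" and [measurable_cong, simp]: "sets M = sets borel" "sets N = sets borel"
  shows "prob_space (M \<star> N)"
proof -
  interpret M: prob_space M by fact
  interpret N: prob_space N by fact
  interpret pair_prob_space M N ..
  show ?thesis unfolding convolution_def by (rule prob_space_distr) measurable
qed

text \<open>The point mass outside \<open>1..k\<close> carries no weight under
  \<open>jump_prob\<close>; it makes the kernel a probability measure at every natural number, as
  the bind over all of them requires.\<close>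

definition D_kernel :: "nat \<Rightarrow> nat \<Rightarrow> real measure" where
  "D_kernel k i = (if 1 \<le> i \<and> i \<le> k then expo (harm k) \<star> D_law i else return borel 0)"

lemma sets_expo [simp]: "sets (expo l) = sets borel"
  by (simp add: expo_def)

lemma sets_D_kernel [simp]: "sets (D_kernel k i) = sets borel"
  by (simp add: D_kernel_def)

lemma prob_space_jump:
  assumes "k \<ge> 1"
  shows "prob_space (density (count_space UNIV) (\<lambda>i. ennreal (jump_prob (Suc k) i)))" (is "prob_space ?J")
proof (rule prob_spaceI)
  have "emeasure ?J (space ?J) = (\<Sum>i=1..k. ennreal (jump_prob (Suc k) i))"
    using nn_integral_jump[of k "\<lambda>_. 1"] by simp
  also have "\<dots> = ennreal (\<Sum>i=1..k. jump_prob (Suc k) i)"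
    by (rule sum_ennreal) (simp add: jump_prob_def harm_nonneg)
  finally show "emeasure ?J (space ?J) = 1" using sum_jump_prob[OF assms] by simp
qed

lemma measurable_D_kernel:
  assumes "\<And>i. prob_space (D_kernel k i)"
  shows "D_kernel k \<in> measurable (density (count_space UNIV) f) (subprob_algebra borel)"
  using assms by (auto simp: measurable_def space_subprob_algebra prob_space_imp_subprob_space)

lemma sets_D_law:
  assumes "n \<ge> 1"
  shows "sets (D_law n) = sets borel"
proof (cases "n = 1")
  case False
  then obtain k where "n = Suc k" "k \<ge> 1" using assms by (cases n) auto
  then show ?thesis by (simp add: D_law_Suc flip: D_kernel_def)
qed (simp add: D_law_1)

lemma prob_space_D_kernel:
  assumes "\<And>i. 1 \<le> i \<Longrightarrow> i \<le> k \<Longrightarrow> prob_space (D_law i)"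
  shows "prob_space (D_kernel k i)"
proof (cases "1 \<le> i \<and> i \<le> k")
  case True
  then have "harm k > (0::real)" using harm_ge_1[of k] by linarith
  then show ?thesis using True assms
    by (auto simp: D_kernel_def sets_D_law intro!: prob_space_convolution prob_space_expo)
qed (auto simp: D_kernel_def intro: prob_space_return)

lemma prob_space_D_law: "n \<ge> 1 \<Longrightarrow> prob_space (D_law n)"
proof (induction n rule: less_induct)
  case (less n)
  show ?case
  proof (cases "n = 1")
    case True
    then show ?thesis by (simp add: D_law_1 prob_space_return)
  next
    case False
    then obtain k where k: "n = Suc k" "k \<ge> 1" using less.prems by (cases n) auto
    have K: "prob_space (D_kernel k i)" for i
      by (rule prob_space_D_kernel) (use less.IH k in auto)
    show ?thesis
      unfolding k(1) D_law_Suc[OF k(2), folded D_kernel_def]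
      by (rule prob_space.prob_space_bind[OF prob_space_jump[OF k(2)] _ measurable_D_kernel[OF K]]) (simp add: K)
  qed
qed

section \<open>Conditioning on the first jump\<close>

lemma nn_integral_exp_expo:
  assumes "l > 0" "z < l"
  shows "(\<integral>\<^sup>+x. ennreal (exp (z * x)) \<partial>expo l) = ennreal (l / (l - z))"
proof -
  interpret prob_space "expo (l - z)" by (rule prob_space_expo) (use assms in simp)
  have "(\<integral>\<^sup>+x. ennreal (exp (z * x)) \<partial>expo l)
      = (\<integral>\<^sup>+x. ennreal (l / (l - z)) * ennreal (exponential_density (l - z) x) \<partial>lborel)"
    unfolding expo_def
  proof (subst nn_integral_density)
    show "(\<integral>\<^sup>+x. ennreal (exponential_density l x) * ennreal (exp (z * x)) \<partial>lborel)
        = (\<integral>\<^sup>+x. ennreal (l / (l - z)) * ennreal (exponential_density (l - z) x) \<partial>lborel)"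
    proof (rule nn_integral_cong)
      fix x :: real
      \<comment> \<open>Exponential tilting: the integrand is a multiple of another exponential
        density, whose total mass is 1.\<close>
      have "exponential_density l x * exp (z * x) = l / (l - z) * exponential_density (l - z) x"
        using assms by (simp add: exponential_density_def flip: exp_add) (simp add: algebra_simps)
      then show "ennreal (exponential_density l x) * ennreal (exp (z * x))
          = ennreal (l / (l - z)) * ennreal (exponential_density (l - z) x)"
        using assms by (simp flip: ennreal_mult')
    qed
  qed measurable
  also have "\<dots> = ennreal (l / (l - z)) * (\<integral>\<^sup>+x. ennreal (exponential_density (l - z) x) \<partial>lborel)"
    by (rule nn_integral_cmult) measurable
  also have "(\<integral>\<^sup>+x. ennreal (exponential_density (l - z) x) \<partial>lborel) = 1"
    using emeasure_space_1 by (simp add: expo_def emeasure_density)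
  finally show ?thesis by simp
qed

text \<open>Extended nonnegative values allow binds and convolutions to be integrated before
  integrability is known; finiteness then comes out of the recurrence.\<close>

definition nn_mgf :: "real \<Rightarrow> nat \<Rightarrow> ennreal" where
  "nn_mgf z n = (\<integral>\<^sup>+x. ennreal (exp (z * x)) \<partial>D_law n)"

text \<open>The holding time is independent of what follows, so it contributes the factor
  \<open>harm k / (harm k - z)\<close>; its numerator cancels the normalising \<open>harm k\<close>
  in \<open>jump_prob\<close>.\<close>

lemma nn_mgf_Suc:
  assumes "z < 1" "k \<ge> 1"
  shows "nn_mgf z (Suc k) = (\<Sum>i=1..k. ennreal (1 / (real (Suc k - i) * (harm k - z))) * nn_mgf z i)"
proof -
  have h: "harm k \<ge> (1::real)" using assms by (simp add: harm_ge_1)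
  have conv: "(\<integral>\<^sup>+x. ennreal (exp (z * x)) \<partial>D_kernel k i)
      = ennreal (harm k / (harm k - z)) * nn_mgf z i" if "i \<in> {1..k}" for i
  proof -
    interpret E: prob_space "expo (harm k)" by (rule prob_space_expo) (use h in linarith)
    interpret D: prob_space "D_law i" using that by (auto intro: prob_space_D_law)
    have [measurable_cong]: "sets (D_law i) = sets borel" "sets (expo (harm k)) = sets borel"
      using that by (simp_all add: sets_D_law)
    have "D_kernel k i = (expo (harm k) \<star> D_law i)"
      using that by (simp add: D_kernel_def)
    then have "(\<integral>\<^sup>+x. ennreal (exp (z * x)) \<partial>D_kernel k i)
        = (\<integral>\<^sup>+x. \<integral>\<^sup>+y. ennreal (exp (z * (x + y))) \<partial>D_law i \<partial>expo (harm k))"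
      using that
      by (simp add: nn_integral_convolution D.finite_measure_axioms E.finite_measure_axioms sets_D_law)
    also have "\<dots> = (\<integral>\<^sup>+x. \<integral>\<^sup>+y. ennreal (exp (z * x)) * ennreal (exp (z * y)) \<partial>D_law i \<partial>expo (harm k))"
      by (simp add: ennreal_mult'[symmetric] exp_add distrib_left)
    also have "\<dots> = (\<integral>\<^sup>+x. ennreal (exp (z * x)) * nn_mgf z i \<partial>expo (harm k))"
      unfolding nn_mgf_def by (intro nn_integral_cong nn_integral_cmult) measurable
    also have "\<dots> = (\<integral>\<^sup>+x. ennreal (exp (z * x)) \<partial>expo (harm k)) * nn_mgf z i"
      by (rule nn_integral_multc) measurable
    finally show ?thesis using h assms by (simp add: nn_integral_exp_expo)
  qed
  have "nn_mgf z (Suc k) = (\<Sum>i=1..k. ennreal (jump_prob (Suc k) i) * (\<integral>\<^sup>+x. ennreal (exp (z * x)) \<partial>D_kernel k i))"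
    unfolding nn_mgf_def D_law_Suc[OF assms(2), folded D_kernel_def] nn_integral_jump[symmetric]
    by (rule nn_integral_bind[OF _ measurable_D_kernel[OF prob_space_D_kernel]])
       (auto simp: prob_space_D_law)
  also have "\<dots> = (\<Sum>i=1..k. ennreal (1 / (real (Suc k - i) * (harm k - z))) * nn_mgf z i)"
  proof (rule sum.cong)
    fix i assume i: "i \<in> {1..k}"
    then have "jump_prob (Suc k) i * (harm k / (harm k - z)) = 1 / (real (Suc k - i) * (harm k - z))"
      using h by (simp add: jump_prob_def del: of_nat_diff)
    moreover have "0 \<le> jump_prob (Suc k) i" using h by (simp add: jump_prob_def)
    ultimately show "ennreal (jump_prob (Suc k) i) * (\<integral>\<^sup>+x. ennreal (exp (z * x)) \<partial>D_kernel k i)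
        = ennreal (1 / (real (Suc k - i) * (harm k - z))) * nn_mgf z i"
      using i h assms by (simp add: conv ennreal_mult'[symmetric] mult.assoc[symmetric])
  qed simp
  finally show ?thesis .
qed

lemma nn_mgf_1: "nn_mgf z (Suc 0) = 1"
  by (simp add: nn_mgf_def D_law_1 nn_integral_return)

lemma nn_mgf_finite:
  assumes "z < 1"
  shows "n \<ge> 1 \<Longrightarrow> nn_mgf z n < \<infinity>"
proof (induction n rule: less_induct)
  case (less n)
  show ?case
  proof (cases "n = 1")
    case False
    then obtain k where "n = Suc k" "k \<ge> 1" using less.prems by (cases n) auto
    then show ?thesis
      using less.IH assms by (auto simp: nn_mgf_Suc ennreal_mult_less_top)
  qed (simp add: nn_mgf_1)
qed

lemma mgf_D_eq_enn2real:
  assumes "n \<ge> 1"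
  shows "mgf_D z n = enn2real (nn_mgf z n)"
proof -
  have [measurable_cong]: "sets (D_law n) = sets borel" using assms by (rule sets_D_law)
  have "(\<lambda>x. exp (z * x)) \<in> borel_measurable (D_law n)" by measurable
  then show ?thesis by (simp add: mgf_D_def nn_mgf_def integral_eq_nn_integral)
qed

lemma mgf_D_1: "mgf_D z (Suc 0) = 1"
  by (simp add: mgf_D_eq_enn2real nn_mgf_1)

lemma enn2real_sum:
  assumes "\<And>i. i \<in> A \<Longrightarrow> f i < (\<infinity>::ennreal)"
  shows "enn2real (\<Sum>i\<in>A. f i) = (\<Sum>i\<in>A. enn2real (f i))"
  using assms by (induction A rule: infinite_finite_induct) (auto simp: enn2real_plus less_top)

lemma mgf_D_recurrence:
  assumes "z < 1" "k \<ge> 1"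
  shows "(harm k - z) * mgf_D z (Suc k) = (\<Sum>i<k. mgf_D z (Suc i) / real (k - i))"
proof -
  have h: "harm k \<ge> (1::real)" using assms by (simp add: harm_ge_1)
  have "mgf_D z (Suc k) = (\<Sum>i=1..k. 1 / (real (Suc k - i) * (harm k - z)) * mgf_D z i)"
  proof -
    have "ennreal (1 / (real (Suc k - i) * (harm k - z))) * nn_mgf z i < \<infinity>" if "i \<in> {1..k}" for i
      using that nn_mgf_finite[OF assms(1), of i] by (simp add: ennreal_mult_less_top del: of_nat_diff)
    then have "enn2real (nn_mgf z (Suc k))
        = (\<Sum>i=1..k. enn2real (ennreal (1 / (real (Suc k - i) * (harm k - z))) * nn_mgf z i))"
      unfolding nn_mgf_Suc[OF assms] by (rule enn2real_sum)
    then show ?thesis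
      using assms h by (simp add: mgf_D_eq_enn2real enn2real_mult del: of_nat_diff)
  qed
  also have "\<dots> = (\<Sum>i<k. 1 / (real (k - i) * (harm k - z)) * mgf_D z (Suc i))"
    by (rule sum.reindex_bij_witness[of _ Suc "\<lambda>i. i - 1"]) auto
  finally show ?thesis using h assms
    by (simp add: sum_distrib_left del: of_nat_diff)
qed

section \<open>The alternating binomial sum\<close>

text \<open>Subtracting \<open>harm N * (N choose j)\<close> shows that the binomial is an
  eigenfunction of the generator, with eigenvalue \<open>- harm j\<close>. The induction rests on
  Pascal's rule.\<close>

lemma sum_choose_div:
  "j \<le> N \<Longrightarrow> (\<Sum>i<N. real (i choose j) / real (N - i)) = (harm N - harm j) * real (N choose j)"
proof (induction N arbitrary: j)
  case (Suc N)
  show ?case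
  proof (cases j)
    case 0
    have "(\<Sum>i<Suc N. 1 / real (Suc N - i)) = (\<Sum>i=1..Suc N. 1 / real i)"
      by (rule sum.reindex_bij_witness[of _ "\<lambda>i. Suc N - i" "\<lambda>i. Suc N - i"]) auto
    then show ?thesis using 0 by (simp add: harm_def inverse_eq_divide)
  next
    case (Suc l)
    \<comment> \<open>Pascal's rule may call for \<open>m = N + 1\<close>, beyond the induction
      hypothesis; there both sides vanish.\<close>
    have IH: "(\<Sum>i<N. real (i choose m) / real (N - i)) = (harm N - harm m) * real (N choose m)" for m
    proof (cases "m \<le> N")
      case False
      then show ?thesis by (simp add: binomial_eq_0)
    qed (use Suc.IH in auto)
    have "(\<Sum>i<Suc N. real (i choose j) / real (Suc N - i)) = (\<Sum>i<N. real (Suc i choose j) / real (N - i))"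
      by (subst sum.lessThan_Suc_shift) (simp add: Suc)
    also have "\<dots> = (harm N - harm l) * real (N choose l) + (harm N - harm j) * real (N choose j)"
      by (simp add: Suc add_divide_distrib sum.distrib IH del: of_nat_diff)
    also have "\<dots> = (harm (Suc N) - harm j) * real (Suc N choose j)"
    proof -
      \<comment> \<open>The absorption identity matches the increments of the two harmonic
        numbers.\<close>
      have "real (Suc N choose j) / real (Suc N) = real (N choose l) / real (Suc l)"
        using Suc_times_binomial[of l N] by (simp add: Suc field_simps del: of_nat_Suc binomial_Suc_Suc flip: of_nat_mult)
      moreover have "real (Suc N choose j) = real (N choose l) + real (N choose j)" by (simp add: Suc)
      moreover have "harm (Suc N) = (harm N + 1 / real (Suc N) :: real)" "harm j = (harm l + 1 / real (Suc l) :: real)"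
        by (simp_all add: Suc harm_Suc inverse_eq_divide)
      ultimately show ?thesis by (simp add: algebra_simps add_divide_distrib)
    qed
    finally show ?thesis .
  qed
qed simp

text \<open>The recurrence and the value at 0 determine \<open>f\<close>, since
  \<open>harm k - z\<close> never vanishes. The right-hand side satisfies both: at 0 it equals
  \<open>-z / (0 - z) = 1\<close>, and for larger arguments it is a combination of
  eigenfunctions.\<close>

lemma harmonic_recurrence_solution:
  fixes f :: "nat \<Rightarrow> real"
  assumes "z < 1" "f 0 = 1"
    and rec: "\<And>k. k \<ge> 1 \<Longrightarrow> (harm k - z) * f k = (\<Sum>i<k. f i / real (k - i))"
    and "z \<noteq> 0"
  shows "f N = (\<Sum>k\<le>N. (-1) ^ k * real (N choose k) * (-z / (harm k - z)))"
proof -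
  define F where "F = (\<lambda>N. \<Sum>k\<le>N. (-1) ^ k * real (N choose k) * (-z / (harm k - z)))"
  have hz: "harm k - z \<noteq> 0" for k
    using harm_mono[of 1 k, where 'a = real] assms by (cases "k = 0") (auto simp: harm_def)
  have Frec: "(harm k - z) * F k = (\<Sum>i<k. F i / real (k - i))" if "k \<ge> 1" for k
  proof -
    have "(\<Sum>i<k. F i / real (k - i)) = (\<Sum>i<k. \<Sum>j\<le>k. (-1) ^ j * real (i choose j) * (-z / (harm j - z)) / real (k - i))"
      unfolding F_def sum_divide_distrib
      by (intro sum.cong refl sum.mono_neutral_left) (auto simp: binomial_eq_0)
    also have "\<dots> = (\<Sum>j\<le>k. (-1) ^ j * (-z / (harm j - z)) * (\<Sum>i<k. real (i choose j) / real (k - i)))"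
      by (subst sum.swap) (simp add: sum_distrib_left mult_ac)
    also have "\<dots> = (\<Sum>j\<le>k. (-1) ^ j * (-z / (harm j - z)) * ((harm k - harm j) * real (k choose j)))"
      by (intro sum.cong refl) (simp add: sum_choose_div del: of_nat_diff)
    also have "\<dots> = (\<Sum>j\<le>k. (harm k - z) * ((-1) ^ j * real (k choose j) * (-z / (harm j - z)))
        + z * ((-1) ^ j * real (k choose j)))"
    proof (rule sum.cong)
      fix j
      \<comment> \<open>This split yields the desired \<open>(harm k - z) * F k\<close> and a
        multiple of the full alternating binomial sum, which is zero for
        \<open>k \<ge> 1\<close>.\<close>
      have "harm k - harm j = (harm k - z) - (harm j - z)" by simp
      then have *: "(-z / (harm j - z)) * (harm k - harm j) = (harm k - z) * (-z / (harm j - z)) + z"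
        using hz[of j] by (simp add: field_simps)
      have "(-1) ^ j * (-z / (harm j - z)) * ((harm k - harm j) * real (k choose j))
        = ((-z / (harm j - z)) * (harm k - harm j)) * ((-1) ^ j * real (k choose j))"
        by (simp only: mult_ac)
      also have "\<dots> = ((harm k - z) * (-z / (harm j - z)) + z) * ((-1) ^ j * real (k choose j))"
        by (simp only: *)
      finally show "(-1) ^ j * (-z / (harm j - z)) * ((harm k - harm j) * real (k choose j))
        = (harm k - z) * ((-1) ^ j * real (k choose j) * (-z / (harm j - z))) + z * ((-1) ^ j * real (k choose j))"
        by (simp only: distrib_left distrib_right mult_ac)
    qed simp
    also have "\<dots> = (harm k - z) * F k + z * (\<Sum>j\<le>k. (-1) ^ j * real (k choose j))"
      by (simp only: F_def sum.distrib sum_distrib_left)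
    also have "(\<Sum>j\<le>k. (-1) ^ j * real (k choose j)) = 0"
      using choose_alternating_sum[of k, where 'a = real] that by simp
    finally show ?thesis by simp
  qed
  have "f N = F N"
  proof (induction N rule: less_induct)
    case (less N)
    show ?case
    proof (cases "N = 0")
      case False
      then have "(harm N - z) * f N = (harm N - z) * F N"
        using less by (simp add: rec Frec)
      then show ?thesis using hz[of N] by simp
    qed (use assms in \<open>simp add: F_def harm_def\<close>)
  qed
  then show ?thesis by (simp add: F_def)
qed

text \<open>The \<open>N\<close>-th difference of the reciprocal. By Pascal's rule the sum for
  \<open>Suc N\<close> at \<open>x\<close> is the sum for \<open>N\<close> at \<open>x\<close> minus
  the sum for \<open>N\<close> at \<open>x + 1\<close>, and the closed form obeys the same
  relation.\<close>

lemma alternating_sum_inverse: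
  fixes x :: "'a :: field_char_0"
  assumes "\<And>k. k \<le> N \<Longrightarrow> x + of_nat k \<noteq> 0"
  shows "(\<Sum>k\<le>N. (-1) ^ k * of_nat (N choose k) / (x + of_nat k)) = fact N / pochhammer x (Suc N)"
  using assms
proof (induction N arbitrary: x)
  case (Suc N)
  have nz: "pochhammer x (Suc (Suc N)) \<noteq> 0"
    using Suc.prems by (auto simp: pochhammer_eq_0_iff add_eq_0_iff2)
  have "(\<Sum>k\<le>Suc N. (-1) ^ k * of_nat (Suc N choose k) / (x + of_nat k))
      = 1 / x + (\<Sum>k\<le>N. (-1) ^ Suc k * (of_nat (N choose k) + of_nat (N choose Suc k)) / (x + of_nat (Suc k)))"
    by (subst sum.atMost_Suc_shift) simp
  also have "\<dots> = (1 / x + (\<Sum>k\<le>N. (-1) ^ Suc k * of_nat (N choose Suc k) / (x + of_nat (Suc k))))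
      - (\<Sum>k\<le>N. (-1) ^ k * of_nat (N choose k) / ((x + 1) + of_nat k))"
    by (simp add: sum_subtractf sum.distrib distrib_left add_divide_distrib diff_divide_distrib add_ac sum_negf
        del: sum.atMost_Suc)
  also have "1 / x + (\<Sum>k\<le>N. (-1) ^ Suc k * of_nat (N choose Suc k) / (x + of_nat (Suc k)))
      = (\<Sum>k\<le>Suc N. (-1) ^ k * of_nat (N choose k) / (x + of_nat k))"
    by (subst sum.atMost_Suc_shift) simp
  also have "\<dots> = (\<Sum>k\<le>N. (-1) ^ k * of_nat (N choose k) / (x + of_nat k))"
    by simp
  also have "\<dots> = fact N / pochhammer x (Suc N)"
    by (rule Suc.IH) (use Suc.prems in auto)
  also have "(\<Sum>k\<le>N. (-1) ^ k * of_nat (N choose k) / ((x + 1) + of_nat k)) = fact N / pochhammer (x + 1) (Suc N)"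
  proof (rule Suc.IH)
    fix k assume "k \<le> N"
    then show "x + 1 + of_nat k \<noteq> 0" using Suc.prems[of "Suc k"] by (simp add: add_ac)
  qed
  also have "fact N / pochhammer x (Suc N) - fact N / pochhammer (x + 1) (Suc N) = fact (Suc N) / pochhammer x (Suc (Suc N))"
  proof -
    have 1: "pochhammer x (Suc (Suc N)) = pochhammer x (Suc N) * (x + of_nat (Suc N))" by (rule pochhammer_Suc)
    have 2: "pochhammer x (Suc (Suc N)) = x * pochhammer (x + 1) (Suc N)" by (rule pochhammer_rec)
    have "fact N / pochhammer x (Suc N) = fact N * (x + of_nat (Suc N)) / pochhammer x (Suc (Suc N))"
      using nz unfolding 1 by simp
    moreover have "fact N / pochhammer (x + 1) (Suc N) = fact N * x / pochhammer x (Suc (Suc N))"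
      using nz unfolding 2 by simp
    ultimately show ?thesis by (simp add: algebra_simps diff_divide_distrib[symmetric])
  qed
  finally show ?case .
qed simp

section \<open>Partial fractions of the truncated digamma function\<close>

text \<open>Lagrange interpolation: a polynomial of degree at most \<open>card R\<close> is
  determined by its values on \<open>R\<close> and its coefficient at \<open>card R\<close>. Writing
  \<open>Q\<close> as a multiple of \<open>P\<close> plus a Lagrange sum and dividing by
  \<open>P\<close> gives the expansion.\<close>

lemma partial_fractions:
  fixes P Q :: "'a :: field poly"
  assumes R: "finite R" "\<And>r. r \<in> R \<Longrightarrow> poly P r = 0" "degree P \<le> card R" "coeff P (card R) \<noteq> 0"
    and deg: "degree Q \<le> card R" and x: "x \<notin> R"
  shows "poly Q x / poly P x = coeff Q (card R) / coeff P (card R)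
           + (\<Sum>r\<in>R. poly Q r / (poly (pderiv P) r * (x - r)))"
proof -
  define c where "c = coeff P (card R)"
  \<comment> \<open>This is \<open>P\<close> with the factor at \<open>r\<close> removed: it
    vanishes at the other roots and takes the value \<open>P'(r)\<close> at
    \<open>r\<close>.\<close>
  define L where "L r = smult c (\<Prod>t\<in>R - {r}. [:- t, 1:])" for r
  have degp: "degree (\<Prod>r\<in>S. [:- r, 1:]) = card S" for S :: "'a set"
    by (simp add: degree_prod_eq_sum_degree)
  have "lead_coeff (\<Prod>r\<in>S. [:- r, 1:]) = 1" for S :: "'a set"
    by (simp add: lead_coeff_prod)
  from this[of R] have "coeff (\<Prod>r\<in>R. [:- r, 1:]) (card R) = 1" by (simp add: degp)
  then have P: "P = smult c (\<Prod>r\<in>R. [:- r, 1:])"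
    using R by (intro poly_eqI_degree_lead_coeff[where A = R and n = "card R"]) (auto simp: c_def degp poly_prod)
  have PL: "P = [:- r, 1:] * L r" if "r \<in> R" for r
    unfolding P L_def using that R(1) by (subst prod.remove[of _ r]) (simp_all add: mult.commute)
  have L_deriv: "poly (pderiv P) r = poly (L r) r" if "r \<in> R" for r
    by (subst PL[OF that]) (simp add: pderiv_mult pderiv_pCons del: mult_pCons_left)
  have L_nz: "poly (L r) r \<noteq> 0" for r
    using R by (auto simp: L_def poly_prod c_def)
  have L_0: "poly (L r) t = 0" if "t \<in> R" "t \<noteq> r" for r t
    using that R(1) by (auto simp: L_def poly_prod)
  have degL: "degree (L r) < card R" if "r \<in> R" for r
    using card_Diff1_less[OF R(1) that] R by (simp add: L_def degp c_def)
  have "Q = smult (coeff Q (card R) / c) P + (\<Sum>r\<in>R. smult (poly Q r / poly (pderiv P) r) (L r))" (is "_ = ?W")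
  proof (rule poly_eqI_degree_lead_coeff[where A = R and n = "card R"])
    show "coeff Q (card R) = coeff ?W (card R)"
      using R degL by (simp add: coeff_sum coeff_eq_0 c_def)
    show "degree ?W \<le> card R"
      using degL R(1,3) by (intro degree_add_le degree_sum_le) (auto intro: less_imp_le order_trans[OF degree_smult_le])
    fix t assume t: "t \<in> R"
    have "(\<Sum>r\<in>R. poly Q r / poly (pderiv P) r * poly (L r) t) = poly Q t / poly (pderiv P) t * poly (L t) t"
      using t R(1) by (subst sum.remove[of _ t]) (auto intro!: sum.neutral, metis L_0)
    then show "poly Q t = poly ?W t"
      using L_nz[of t] t R(2) by (simp add: poly_sum L_deriv)
  qed (use deg in auto)
  from arg_cong[OF this, of "\<lambda>p. poly p x"]
  have "poly Q x = coeff Q (card R) / c * poly P x + (\<Sum>r\<in>R. poly Q r / poly (pderiv P) r * poly (L r) x)"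
    by (simp only: poly_add poly_smult poly_sum)
  moreover have Px: "poly P x \<noteq> 0" using R x by (subst P) (auto simp: poly_prod c_def)
  moreover have "poly Q r / poly (pderiv P) r * poly (L r) x / poly P x = poly Q r / (poly (pderiv P) r * (x - r))"
    if "r \<in> R" for r
    using arg_cong[OF PL[OF that], of "\<lambda>p. poly p x"] Px by (simp del: mult_pCons_left)
  ultimately show ?thesis
    by (simp add: add_divide_distrib sum_divide_distrib c_def)
qed

definition gap_trunc :: "nat \<Rightarrow> real \<Rightarrow> real" where
  "gap_trunc M s = (\<Sum>m=1..M. 1 / real m - 1 / (real m + s))"

definition gap_trunc_deriv :: "nat \<Rightarrow> real \<Rightarrow> real" where
  "gap_trunc_deriv M s = (\<Sum>m=1..M. 1 / (real m + s)\<^sup>2)"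

lemma DERIV_gap_trunc:
  assumes "\<And>m. m \<in> {1..M} \<Longrightarrow> real m + s \<noteq> 0"
  shows "(gap_trunc M has_real_derivative gap_trunc_deriv M s) (at s)"
  unfolding gap_trunc_def[abs_def] gap_trunc_deriv_def using assms
  by (auto intro!: derivative_eq_intros sum.cong simp: power2_eq_square)

lemma gap_trunc_mono_pos: "-1 < s \<Longrightarrow> s < t \<Longrightarrow> M \<ge> 1 \<Longrightarrow> gap_trunc M s < gap_trunc M t"
  unfolding gap_trunc_def by (intro sum_strict_mono diff_strict_left_mono divide_strict_left_mono) auto

text \<open>No pole lies strictly between -2 and -1, and each summand increases there. For
  \<open>m = 1\<close> both denominators are negative, so their product is still positive. This
  serves to locate the largest root below -1.\<close>

lemma gap_trunc_mono_neg:
  assumes "-2 < s" "s < t" "t < -1"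
  shows "gap_trunc M s \<le> gap_trunc M t"
  unfolding gap_trunc_def
proof (intro sum_mono diff_left_mono)
  fix m assume "m \<in> {1..M}"
  moreover have "0 < (real m + t) * (real m + s)"
  proof (cases "m = 1")
    case False
    then have "real m \<ge> 2" using \<open>m \<in> {1..M}\<close> by simp
    then show ?thesis using assms by simp
  qed (use assms in \<open>auto simp: zero_less_mult_iff\<close>)
  ultimately show "1 / (real m + t) \<le> 1 / (real m + s)"
    using assms by (intro divide_left_mono) auto
qed

lemma gap_trunc_deriv_pos: "M \<ge> 1 \<Longrightarrow> (\<And>m. m \<in> {1..M} \<Longrightarrow> real m + s \<noteq> 0) \<Longrightarrow> gap_trunc_deriv M s > 0"
  unfolding gap_trunc_deriv_def by (intro sum_pos) auto

definition denom_poly :: "nat \<Rightarrow> real poly" where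
  "denom_poly M = (\<Prod>m=1..M. [:real m, 1:])"

text \<open>The numerator of \<open>gap_trunc M s - z\<close> over the common denominator
  \<open>denom_poly M\<close>. Written without division, it can also be evaluated at the poles
  \<open>-m\<close>, where its signs separate the roots.\<close>

definition numer_poly :: "nat \<Rightarrow> real \<Rightarrow> real poly" where
  "numer_poly M z = smult (harm M - z) (denom_poly M) - (\<Sum>m=1..M. \<Prod>l\<in>{1..M}-{m}. [:real l, 1:])"

lemma degree_prod_linear: "finite S \<Longrightarrow> degree (\<Prod>l\<in>S. [:real l, 1:]) = card S"
  by (simp add: degree_prod_eq_sum_degree)

lemma degree_denom_poly: "degree (denom_poly M) = M" and coeff_denom_poly: "coeff (denom_poly M) M = 1"
proof -
  show 1: "degree (denom_poly M) = M" by (simp add: denom_poly_def degree_prod_linear)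
  have "lead_coeff (denom_poly M) = 1" by (simp add: denom_poly_def lead_coeff_prod)
  then show "coeff (denom_poly M) M = 1" by (simp add: 1)
qed

lemma degree_numer_poly: "degree (numer_poly M z) \<le> M" and coeff_numer_poly: "M \<ge> 1 \<Longrightarrow> coeff (numer_poly M z) M = harm M - z"
proof -
  show "degree (numer_poly M z) \<le> M"
    unfolding numer_poly_def
    by (intro degree_diff_le degree_sum_le order_trans[OF degree_smult_le]) (auto simp: degree_denom_poly degree_prod_linear)
  show "coeff (numer_poly M z) M = harm M - z" if "M \<ge> 1"
    using that by (auto simp: numer_poly_def coeff_denom_poly coeff_sum degree_prod_linear intro!: sum.neutral coeff_eq_0)
qed

lemma poly_denom_poly: "poly (denom_poly M) s = (\<Prod>m=1..M. real m + s)"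
  by (simp add: denom_poly_def poly_prod)

lemma poly_numer_poly:
  assumes "\<And>m. m \<in> {1..M} \<Longrightarrow> real m + s \<noteq> 0"
  shows "poly (numer_poly M z) s = poly (denom_poly M) s * (gap_trunc M s - z)"
proof -
  have "(\<Sum>m=1..M. \<Prod>l\<in>{1..M}-{m}. real l + s) = (\<Sum>m=1..M. poly (denom_poly M) s / (real m + s))"
  proof (rule sum.cong)
    fix m assume m: "m \<in> {1..M}"
    show "(\<Prod>l\<in>{1..M}-{m}. real l + s) = poly (denom_poly M) s / (real m + s)"
      using assms[OF m] prod.remove[of "{1..M}" m "\<lambda>m. real m + s"] m by (simp add: poly_denom_poly)
  qed simp
  then show ?thesis
    by (simp add: numer_poly_def gap_trunc_def harm_def poly_sum poly_prod sum_subtractf sum_distrib_left right_diff_distrib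
        inverse_eq_divide mult.commute)
qed

text \<open>At \<open>-m\<close> only the product omitting the factor \<open>m\<close> survives; it
  has \<open>m - 1\<close> negative factors, and the minus sign in front supplies one more.\<close>

lemma poly_numer_poly_sign:
  assumes "m \<in> {1..M}"
  shows "(-1) ^ m * poly (numer_poly M z) (- real m) > 0"
proof -
  have Q0: "poly (denom_poly M) (- real m) = 0" using assms by (force simp: poly_denom_poly)
  have "(\<Sum>l=1..M. \<Prod>k\<in>{1..M}-{l}. real k - real m) = (\<Prod>k\<in>{1..M}-{m}. real k - real m)"
  proof (subst sum.remove[of _ m])
    show "(\<Prod>k\<in>{1..M}-{m}. real k - real m) + (\<Sum>l\<in>{1..M}-{m}. \<Prod>k\<in>{1..M}-{l}. real k - real m) = (\<Prod>k\<in>{1..M}-{m}. real k - real m)"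
      using assms by (auto intro!: sum.neutral bexI[of _ m])
  qed (use assms in auto)
  moreover have "{1..M} - {m} = {1..<m} \<union> {m<..M}" using assms by auto
  moreover have "(\<Prod>k\<in>{1..<m} \<union> {m<..M}. real k - real m) = (\<Prod>k\<in>{1..<m}. real k - real m) * (\<Prod>k\<in>{m<..M}. real k - real m)"
    by (rule prod.union_disjoint) auto
  moreover have "(\<Prod>k\<in>{1..<m}. real k - real m) = (-1) ^ (m - 1) * (\<Prod>k\<in>{1..<m}. real m - real k)"
    using prod_uminus[of "\<lambda>k. real m - real k" "{1..<m}"] by simp
  ultimately have "poly (numer_poly M z) (- real m) = - ((-1) ^ (m - 1) * (\<Prod>k\<in>{1..<m}. real m - real k) * (\<Prod>k\<in>{m<..M}. real k - real m))"
    by (simp add: numer_poly_def Q0 poly_sum poly_prod)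
  moreover have "(-1::real) ^ m = - ((-1) ^ (m - 1))" using assms by (cases m) auto
  ultimately have "(-1) ^ m * poly (numer_poly M z) (- real m)
      = ((-1) ^ (m - 1) * (-1) ^ (m - 1)) * ((\<Prod>k\<in>{1..<m}. real m - real k) * (\<Prod>k\<in>{m<..M}. real k - real m))"
    by simp
  also have "(-1::real) ^ (m - 1) * (-1) ^ (m - 1) = 1" by (simp flip: power_mult_distrib)
  finally show ?thesis by (auto intro!: mult_pos_pos prod_pos)
qed

lemma numer_poly_roots:
  assumes "1 \<le> m" "m < M"
  shows "\<exists>r. - real m - 1 < r \<and> r < - real m \<and> poly (numer_poly M z) r = 0"
proof -
  have s: "(-1) ^ m * poly (numer_poly M z) (- real m) > 0" "(-1) ^ Suc m * poly (numer_poly M z) (- real (Suc m)) > 0"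
    using assms by (intro poly_numer_poly_sign; simp)+
  have "poly (numer_poly M z) (- real (Suc m)) * poly (numer_poly M z) (- real m) < 0"
    using s by (cases "even m") (auto simp: mult_less_0_iff)
  from poly_IVT[OF _ this] obtain r where "- real (Suc m) < r" "r < - real m" "poly (numer_poly M z) r = 0"
    by auto
  then show ?thesis by (intro exI[of _ r]) auto
qed

text \<open>The sign changes give one root between each two neighbouring poles; these
  \<open>M - 1\<close> roots together with \<open>r0\<close> are as many as the degree allows. The
  residue at a root is the reciprocal of the positive \<open>gap_trunc_deriv\<close>.\<close>

lemma gap_trunc_partial_fractions:
  assumes "M \<ge> 2" and r0: "-1 < r0" "r0 < 1" and \<sigma>: "1 < \<sigma>" "\<sigma> < 2" "gap_trunc M r0 < gap_trunc M (-\<sigma>)"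
  obtains R c K where "finite R" "\<And>r. r \<in> R \<Longrightarrow> r \<le> -\<sigma>" "\<And>r. r \<in> R \<Longrightarrow> c r > 0" "K > (0::real)"
    "\<And>x. x > -1 \<Longrightarrow> x \<noteq> r0 \<Longrightarrow>
      1 / (gap_trunc M x - gap_trunc M r0) = K + 1 / (gap_trunc_deriv M r0 * (x - r0)) + (\<Sum>r\<in>R. c r / (x - r))"
proof -
  define z where "z = gap_trunc M r0"
  have M1: "M \<ge> 1" using assms by simp
  let ?P = "numer_poly M z"
  \<comment> \<open>\<open>harm M\<close> is the value of \<open>gap_trunc M\<close> at infinity.
    That it exceeds \<open>z\<close> makes the leading coefficient of the numerator nonzero and the
    constant \<open>K\<close> positive.\<close>
  have "z < gap_trunc M 1" unfolding z_def using assms by (intro gap_trunc_mono_pos) auto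
  moreover have "gap_trunc M 1 \<le> harm M"
    unfolding gap_trunc_def harm_def by (intro sum_mono) (auto simp: inverse_eq_divide)
  ultimately have zh: "z < harm M" by simp
  have "\<exists>\<rho>. \<forall>m\<in>{1..<M}. - real m - 1 < \<rho> m \<and> \<rho> m < - real m \<and> poly ?P (\<rho> m) = 0"
    using numer_poly_roots by (intro bchoice) auto
  then obtain \<rho> where \<rho>: "\<And>m. m \<in> {1..<M} \<Longrightarrow> - real m - 1 < \<rho> m \<and> \<rho> m < - real m \<and> poly ?P (\<rho> m) = 0"
    by blast
  define R where "R = \<rho> ` {1..<M}"
  have "\<rho> i \<noteq> \<rho> j" if "i \<in> {1..<M}" "j \<in> {1..<M}" "i < j" for i j
    using \<rho>[OF that(1)] \<rho>[OF that(2)] that(3) by linarith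
  then have "inj_on \<rho> {1..<M}" by (metis inj_onI linorder_neqE_nat)
  then have cardR: "card R = M - 1" by (simp add: R_def card_image)
  have fin: "finite R" by (simp add: R_def)
  have r0R: "r0 \<notin> R"
  proof
    assume "r0 \<in> R"
    then obtain m where "m \<in> {1..<M}" "r0 = \<rho> m" by (auto simp: R_def)
    then show False using \<rho>[of m] r0 by auto
  qed
  have card: "card (insert r0 R) = M" using cardR fin r0R assms by simp
  have nz: "real m + r \<noteq> 0" if "m \<in> {1..M}" "poly ?P r = 0" for m r
  proof
    assume "real m + r = 0"
    then have "r = - real m" by simp
    then show False using poly_numer_poly_sign[OF that(1), of z] that(2) by simp
  qed
  have "poly ?P r0 = 0" using r0 by (subst poly_numer_poly) (auto simp: z_def)
  then have roots: "poly ?P r = 0" if "r \<in> insert r0 R" for r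
    using that \<rho> by (auto simp: R_def)
  have nzr: "real m + r \<noteq> 0" if "r \<in> insert r0 R" "m \<in> {1..M}" for m r
    by (rule nz[OF that(2) roots[OF that(1)]])
  have Qnz: "poly (denom_poly M) r \<noteq> 0" if "\<And>m. m \<in> {1..M} \<Longrightarrow> real m + r \<noteq> 0" for r
    unfolding poly_denom_poly using that by auto
  have gap_trunc_root: "gap_trunc M r = z" if "r \<in> insert r0 R" for r
  proof -
    have "poly (denom_poly M) r * (gap_trunc M r - z) = 0"
      by (subst poly_numer_poly[symmetric], erule nzr[OF that], rule roots[OF that])
    moreover have "poly (denom_poly M) r \<noteq> 0" by (rule Qnz, rule nzr[OF that])
    ultimately show ?thesis by simp
  qed
  have deriv: "poly (pderiv ?P) r = poly (denom_poly M) r * gap_trunc_deriv M r" if "r \<in> insert r0 R" for r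
  proof -
    \<comment> \<open>At a root the second factor vanishes, so one term of the product rule remains.
      The product equals the polynomial only off the poles, hence the open set below.\<close>
    have "((\<lambda>s. poly (denom_poly M) s * (gap_trunc M s - z)) has_real_derivative poly (denom_poly M) r * gap_trunc_deriv M r) (at r)"
      using gap_trunc_root[OF that] by (auto intro!: derivative_eq_intros DERIV_gap_trunc nzr[OF that])
    moreover have "open (\<Inter>m\<in>{1..M}. {s. real m + s \<noteq> 0})"
      by (intro open_INT ballI open_Collect_neq continuous_intros) auto
    ultimately have "(poly ?P has_real_derivative poly (denom_poly M) r * gap_trunc_deriv M r) (at r)"
      by (rule has_field_derivative_transform_within_open) (use nzr[OF that] in \<open>auto intro!: poly_numer_poly[symmetric]\<close>)
    from DERIV_unique[OF poly_DERIV[of ?P r] this] show ?thesis .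
  qed
  show thesis
  proof (rule that[of R "\<lambda>r. 1 / gap_trunc_deriv M r" "1 / (harm M - z)"])
    show "r \<le> -\<sigma>" if rR: "r \<in> R" for r
    proof (rule ccontr)
      assume r: "\<not> r \<le> -\<sigma>"
      obtain m where m: "m \<in> {1..<M}" "r = \<rho> m" using rR by (auto simp: R_def)
      then have "r < -1" using \<rho>[of m] by auto
      \<comment> \<open>A root above \<open>-\<sigma>\<close> would lie in \<open>(-2, -1)\<close>,
        where monotonicity forces a value larger than \<open>z\<close>.\<close>
      then have "gap_trunc M (-\<sigma>) \<le> gap_trunc M r" using r \<sigma> by (intro gap_trunc_mono_neg) auto
      then show False using \<sigma>(3) gap_trunc_root[of r] rR by (simp add: z_def)
    qed
    show "1 / gap_trunc_deriv M r > 0" if "r \<in> R" for r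
    proof -
      have "gap_trunc_deriv M r > 0" by (rule gap_trunc_deriv_pos[OF M1 nzr]) (use that in auto)
      then show ?thesis by simp
    qed
    fix x assume x: "x > -1" "x \<noteq> r0"
    have "x \<notin> R"
    proof
      assume "x \<in> R"
      then obtain m where "m \<in> {1..<M}" "x = \<rho> m" by (auto simp: R_def)
      then show False using \<rho>[of m] x by auto
    qed
    have "poly (denom_poly M) x / poly ?P x = coeff (denom_poly M) M / coeff ?P M + (\<Sum>r\<in>insert r0 R. poly (denom_poly M) r / (poly (pderiv ?P) r * (x - r)))"
    proof (rule partial_fractions[of "insert r0 R" ?P "denom_poly M" x, unfolded card])
      show "degree ?P \<le> M" "degree (denom_poly M) \<le> M"
        by (simp_all only: degree_numer_poly degree_denom_poly order_refl)
      show "coeff ?P M \<noteq> 0"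
        using zh by (simp add: coeff_numer_poly[OF M1])
    qed (use fin roots x \<open>x \<notin> R\<close> in auto)
    also have "(\<Sum>r\<in>insert r0 R. poly (denom_poly M) r / (poly (pderiv ?P) r * (x - r))) = (\<Sum>r\<in>insert r0 R. 1 / (gap_trunc_deriv M r * (x - r)))"
    proof (rule sum.cong)
      fix r assume r: "r \<in> insert r0 R"
      have "poly (denom_poly M) r \<noteq> 0" by (rule Qnz, rule nzr[OF r])
      then show "poly (denom_poly M) r / (poly (pderiv ?P) r * (x - r)) = 1 / (gap_trunc_deriv M r * (x - r))"
        by (simp add: deriv[OF r])
    qed simp
    also have "coeff (denom_poly M) M / coeff ?P M = 1 / (harm M - z)"
      by (simp add: coeff_denom_poly coeff_numer_poly[OF M1])
    also have "poly (denom_poly M) x / poly ?P x = 1 / (gap_trunc M x - z)"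
    proof -
      have nzx: "real m + x \<noteq> 0" if "m \<in> {1..M}" for m using x that by auto
      have "poly (denom_poly M) x \<noteq> 0" by (rule Qnz, rule nzx)
      moreover have "poly ?P x = poly (denom_poly M) x * (gap_trunc M x - z)" by (rule poly_numer_poly, rule nzx)
      ultimately show ?thesis by simp
    qed
    finally show "1 / (gap_trunc M x - gap_trunc M r0) = 1 / (harm M - z) + 1 / (gap_trunc_deriv M r0 * (x - r0)) + (\<Sum>r\<in>R. 1 / gap_trunc_deriv M r / (x - r))"
      using fin r0R by (simp add: z_def)
  qed (use fin zh in auto)
qed

section \<open>The contribution of the remaining poles\<close>

text \<open>For positive \<open>x\<close> the Beta function at \<open>x\<close> and
  \<open>N + 1\<close>; the formula also continues it to negative non-integers, as needed for
  positive \<open>rho z\<close>.\<close>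

definition beta_coeff :: "real \<Rightarrow> nat \<Rightarrow> real" where
  "beta_coeff x N = fact N / pochhammer x (Suc N)"

lemma beta_coeff_pos: "x > 0 \<Longrightarrow> beta_coeff x N > 0"
  by (simp add: beta_coeff_def pochhammer_pos)

text \<open>For \<open>N \<ge> 1\<close> the weight cancels the factor \<open>1 + b\<close> of the
  Pochhammer symbol, and the remaining factors of the denominator increase in \<open>b\<close>. With
  \<open>b = -r\<close> the weight is the \<open>1 - r\<close> that matches the partial fractions at
  1.\<close>

lemma beta_coeff_decreasing:
  assumes "0 < a" "a \<le> b" "N \<ge> 1"
  shows "(1 + b) * beta_coeff b N \<le> (1 + a) * beta_coeff a N"
proof -
  obtain n where n: "N = Suc n" using assms(3) by (cases N) auto
  have eq: "(1 + x) * beta_coeff x N = fact N / (x * pochhammer (x + 1 + 1) n)" if "x > 0" for x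
  proof -
    have "pochhammer x (Suc N) = x * ((1 + x) * pochhammer (x + 1 + 1) n)"
      by (simp only: n pochhammer_rec add.commute[of 1 x])
    then show ?thesis using that by (simp add: beta_coeff_def)
  qed
  have "pochhammer (a + 1 + 1) n \<le> pochhammer (b + 1 + 1) n"
    unfolding pochhammer_prod using assms by (intro prod_mono) auto
  then show ?thesis
    using assms by (simp add: eq) (intro divide_left_mono mult_mono mult_pos_pos pochhammer_pos; simp add: less_imp_le pochhammer_pos)
qed

text \<open>Up to a power of \<open>n - 1\<close> this is Euler's sequence for Gamma, which
  converges and so is bounded; \<open>2 powr x\<close> pays for replacing \<open>n - 1\<close> by
  \<open>n\<close>.\<close>

lemma beta_coeff_bigo:
  assumes "x > 0"
  shows "\<exists>K. \<forall>n\<ge>2. beta_coeff x (n - 1) \<le> K * real n powr (- x)"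
proof -
  have "Bseq (Gamma_series x)"
    using Gamma_series_LIMSEQ convergent_imp_Bseq convergentI by blast
  then obtain C where C: "\<And>n. \<bar>Gamma_series x n\<bar> \<le> C" by (auto simp: Bseq_def)
  show ?thesis
  proof (intro exI[of _ "C * 2 powr x"] allI impI)
    fix n :: nat assume n: "n \<ge> 2"
    have "Gamma_series x (n - 1) = beta_coeff x (n - 1) * real (n - 1) powr x"
      using n by (simp add: Gamma_series_def beta_coeff_def powr_def)
    then have "beta_coeff x (n - 1) * real (n - 1) powr x \<le> C" using C[of "n - 1"] by linarith
    moreover have "(real n / 2) powr x \<le> real (n - 1) powr x"
      using n assms by (intro powr_mono2) auto
    ultimately have "beta_coeff x (n - 1) * (real n / 2) powr x \<le> C"
      using beta_coeff_pos[OF assms, of "n - 1"] mult_left_mono by (meson less_imp_le order_trans)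
    then show "beta_coeff x (n - 1) \<le> C * 2 powr x * real n powr (- x)"
      using n by (simp add: powr_divide powr_minus field_simps)
  qed
qed

lemma gap_trunc_sum_estimate:
  assumes "M \<ge> 2" and r0: "-1 < r0" "r0 < 1" "r0 \<noteq> 0"
    and \<sigma>: "1 < \<sigma>" "\<sigma> < 2" "gap_trunc M r0 < gap_trunc M (-\<sigma>)" and "N \<ge> 1"
  shows "\<bar>(\<Sum>k\<le>N. (-1) ^ k * real (N choose k) / (gap_trunc M k - gap_trunc M r0)) - beta_coeff (- r0) N / gap_trunc_deriv M r0\<bar>
           \<le> (1 + \<sigma>) * beta_coeff \<sigma> N / (gap_trunc M 1 - gap_trunc M r0)"
proof -
  from gap_trunc_partial_fractions[OF assms(1) r0(1,2) \<sigma>] obtain R c K where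
    R: "finite R" "\<And>r. r \<in> R \<Longrightarrow> r \<le> -\<sigma>" "\<And>r. r \<in> R \<Longrightarrow> c r > 0" and K: "K > (0::real)"
    and pf: "\<And>x. x > -1 \<Longrightarrow> x \<noteq> r0 \<Longrightarrow>
      1 / (gap_trunc M x - gap_trunc M r0) = K + 1 / (gap_trunc_deriv M r0 * (x - r0)) + (\<Sum>r\<in>R. c r / (x - r))"
    by blast
  have r0k: "real k \<noteq> r0" for k using r0 by (cases k) auto
  have beta: "(\<Sum>k\<le>N. (-1) ^ k * real (N choose k) / (real k - r)) = beta_coeff (- r) N"
    if "\<And>k. real k \<noteq> r" for r
    using alternating_sum_inverse[of N "- r"] that by (simp add: beta_coeff_def)
  \<comment> \<open>The difference operator kills the constant term \<open>K\<close>, as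
    \<open>N \<ge> 1\<close>.\<close>
  have alt0: "(\<Sum>k\<le>N. (-1) ^ k * real (N choose k)) = 0"
    using choose_alternating_sum[of N, where 'a = real] assms by simp
  have "(\<Sum>k\<le>N. (-1) ^ k * real (N choose k) / (gap_trunc M k - gap_trunc M r0))
      = (\<Sum>k\<le>N. (-1) ^ k * real (N choose k) * (K + 1 / (gap_trunc_deriv M r0 * (real k - r0)) + (\<Sum>r\<in>R. c r / (real k - r))))"
  proof (rule sum.cong)
    fix k
    have "1 / (gap_trunc M k - gap_trunc M r0) = K + 1 / (gap_trunc_deriv M r0 * (real k - r0)) + (\<Sum>r\<in>R. c r / (real k - r))"
      using r0k[of k] by (intro pf) auto
    then show "(-1) ^ k * real (N choose k) / (gap_trunc M k - gap_trunc M r0)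
      = (-1) ^ k * real (N choose k) * (K + 1 / (gap_trunc_deriv M r0 * (real k - r0)) + (\<Sum>r\<in>R. c r / (real k - r)))"
      by (metis mult.right_neutral times_divide_eq_right)
  qed simp
  also have "\<dots> = K * (\<Sum>k\<le>N. (-1) ^ k * real (N choose k))
      + (\<Sum>k\<le>N. (-1) ^ k * real (N choose k) / (real k - r0)) / gap_trunc_deriv M r0
      + (\<Sum>r\<in>R. c r * (\<Sum>k\<le>N. (-1) ^ k * real (N choose k) / (real k - r)))"
    unfolding sum_distrib_left sum_divide_distrib
    by (subst sum.swap) (simp add: sum.distrib[symmetric] sum_distrib_left distrib_left mult_ac)
  also have "\<dots> = beta_coeff (- r0) N / gap_trunc_deriv M r0 + (\<Sum>r\<in>R. c r * beta_coeff (- r) N)"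
  proof -
    have "(\<Sum>r\<in>R. c r * (\<Sum>k\<le>N. (-1) ^ k * real (N choose k) / (real k - r))) = (\<Sum>r\<in>R. c r * beta_coeff (- r) N)"
    proof (rule sum.cong)
      fix r assume "r \<in> R"
      then have "real k \<noteq> r" for k using R(2)[of r] \<sigma> by auto
      then show "c r * (\<Sum>k\<le>N. (-1) ^ k * real (N choose k) / (real k - r)) = c r * beta_coeff (- r) N"
        by (simp add: beta)
    qed simp
    then show ?thesis using beta[of r0] r0k by (simp add: alt0)
  qed
  finally have *: "(\<Sum>k\<le>N. (-1) ^ k * real (N choose k) / (gap_trunc M k - gap_trunc M r0)) - beta_coeff (- r0) N / gap_trunc_deriv M r0
      = (\<Sum>r\<in>R. c r * beta_coeff (- r) N)" by simp
  \<comment> \<open>Positive residues make the error nonnegative, so an upper bound is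
    enough.\<close>
  have nonneg: "0 \<le> (\<Sum>r\<in>R. c r * beta_coeff (- r) N)"
    using R \<sigma> by (intro sum_nonneg mult_nonneg_nonneg less_imp_le beta_coeff_pos) force+
  have "(\<Sum>r\<in>R. c r * beta_coeff (- r) N) \<le> (\<Sum>r\<in>R. c r / (1 - r) * ((1 + \<sigma>) * beta_coeff \<sigma> N))"
  proof (rule sum_mono)
    fix r assume r: "r \<in> R"
    have "(1 + (- r)) * beta_coeff (- r) N \<le> (1 + \<sigma>) * beta_coeff \<sigma> N"
      using R(2)[OF r] \<sigma> assms by (intro beta_coeff_decreasing) auto
    then have "c r / (1 - r) * ((1 - r) * beta_coeff (- r) N) \<le> c r / (1 - r) * ((1 + \<sigma>) * beta_coeff \<sigma> N)"
      using R(2,3)[OF r] \<sigma> by (intro mult_left_mono) auto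
    then show "c r * beta_coeff (- r) N \<le> c r / (1 - r) * ((1 + \<sigma>) * beta_coeff \<sigma> N)"
      using R(2)[OF r] \<sigma> by simp
  qed
  also have "\<dots> = (\<Sum>r\<in>R. c r / (1 - r)) * ((1 + \<sigma>) * beta_coeff \<sigma> N)"
    by (simp add: sum_distrib_right)
  also have "\<dots> \<le> 1 / (gap_trunc M 1 - gap_trunc M r0) * ((1 + \<sigma>) * beta_coeff \<sigma> N)"
  proof (rule mult_right_mono)
    \<comment> \<open>In the expansion at 1 the constant and the term of \<open>r0 < 1\<close> are
      positive and may be dropped. The resulting bound depends neither on the number of poles nor on
      their positions.\<close>
    have "0 < gap_trunc_deriv M r0 * (1 - r0)"
      using r0 assms by (intro mult_pos_pos gap_trunc_deriv_pos) auto
    then show "(\<Sum>r\<in>R. c r / (1 - r)) \<le> 1 / (gap_trunc M 1 - gap_trunc M r0)"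
      using pf[of 1] r0 K by simp
    show "0 \<le> (1 + \<sigma>) * beta_coeff \<sigma> N" using \<sigma> beta_coeff_pos[of \<sigma> N] by simp
  qed
  finally show ?thesis unfolding * using nonneg by simp
qed

section \<open>The digamma difference as the limit of its truncations\<close>

definition digamma_gap :: "real \<Rightarrow> real" where
  "digamma_gap s = Digamma (1 + s) - Digamma 1"

lemma summable_digamma_gap: "1 + s \<noteq> 0 \<Longrightarrow> summable (\<lambda>k. 1 / real (Suc k) - 1 / (real (Suc k) + s))"
  using summable_Digamma[of "1 + s"] by (simp add: inverse_eq_divide add_ac)

lemma suminf_digamma_gap: "1 + s \<noteq> 0 \<Longrightarrow> (\<Sum>k. 1 / real (Suc k) - 1 / (real (Suc k) + s)) = digamma_gap s"
  by (simp add: digamma_gap_def Digamma_def[of "1 + s"] inverse_eq_divide add_ac)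

lemma gap_trunc_altdef: "gap_trunc M s = (\<Sum>k<M. 1 / real (Suc k) - 1 / (real (Suc k) + s))"
  by (simp only: gap_trunc_def One_nat_def sum.atLeast1_atMost_eq)

lemma gap_trunc_LIMSEQ:
  assumes "1 + s \<noteq> 0"
  shows "(\<lambda>M. gap_trunc M s) \<longlonglongrightarrow> digamma_gap s"
  using summable_LIMSEQ[OF summable_digamma_gap[OF assms]] unfolding gap_trunc_altdef suminf_digamma_gap[OF assms] .

lemma gap_trunc_deriv_LIMSEQ: "1 + s \<noteq> 0 \<Longrightarrow> (\<lambda>M. gap_trunc_deriv M s) \<longlonglongrightarrow> Polygamma 1 (1 + s)"
proof -
  assume s: "1 + s \<noteq> 0"
  have "(\<lambda>M. \<Sum>k<M. inverse ((1 + s + real k)^2)) \<longlonglongrightarrow> (\<Sum>k. inverse ((1 + s + real k)^2))"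
    by (rule summable_LIMSEQ[OF Polygamma_converges'[OF s]]) simp
  moreover have "(\<Sum>k<M. inverse ((1 + s + real k)^2)) = gap_trunc_deriv M s" for M
    by (simp add: gap_trunc_deriv_def sum.atLeast1_atMost_eq inverse_eq_divide add_ac)
  ultimately show ?thesis by (simp add: Polygamma_def numeral_2_eq_2)
qed

text \<open>At \<open>-\<sigma>\<close> every summand after the first is nonpositive, so partial
  sums stay above the limit. A bound on the pole positions known for the full series thus passes to
  every truncation.\<close>

lemma gap_trunc_ge_digamma_gap:
  assumes "1 < \<sigma>" "\<sigma> < 2" "M \<ge> 1"
  shows "gap_trunc M (-\<sigma>) \<ge> digamma_gap (-\<sigma>)"
proof -
  have "sum (\<lambda>k. - (1 / real (Suc k) - 1 / (real (Suc k) + - \<sigma>))) {..<M} \<le> (\<Sum>k. - (1 / real (Suc k) - 1 / (real (Suc k) + - \<sigma>)))"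
  proof (rule sum_le_suminf)
    show "summable (\<lambda>k. - (1 / real (Suc k) - 1 / (real (Suc k) + - \<sigma>)))"
      using assms by (intro summable_minus summable_digamma_gap) auto
    fix k assume "k \<in> - {..<M}"
    then have "real (Suc k) \<ge> 2" using assms by simp
    then have "1 / real (Suc k) \<le> 1 / (real (Suc k) + - \<sigma>)"
      using assms by (intro divide_left_mono mult_pos_pos) auto
    then show "0 \<le> - (1 / real (Suc k) - 1 / (real (Suc k) + - \<sigma>))" by simp
  qed simp
  then show ?thesis
    using suminf_minus[OF summable_digamma_gap[of "-\<sigma>"]] suminf_digamma_gap[of "-\<sigma>"] assms
    unfolding gap_trunc_altdef sum_negf by simp
qed

lemma digamma_gap_of_nat: "digamma_gap (real k) = harm k"
  using Digamma_of_nat[of k, where 'a = real] by (simp add: digamma_gap_def add.commute)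

section \<open>The asymptotic expansion\<close>

lemma not_nonpos_Ints_gt_minus_1: "(x::real) > -1 \<Longrightarrow> x \<noteq> 0 \<Longrightarrow> x \<notin> \<int>\<^sub>\<le>\<^sub>0"
  by (auto elim!: nonpos_Ints_cases)

lemma not_nonpos_Ints_pos: "(x::real) > 0 \<Longrightarrow> x \<notin> \<int>\<^sub>\<le>\<^sub>0"
  by (auto elim!: nonpos_Ints_cases)

lemma Digamma_2_minus_Digamma_1: "Digamma (2::real) - Digamma 1 = 1"
  using Digamma_plus1[of "1::real"] by simp

section \<open>The roots \<open>rho\<close>, \<open>s1\<close> and the exponent
  \<open>sigma_star\<close>\<close>

lemma digamma_gap_strict_mono: "-1 < s \<Longrightarrow> s < t \<Longrightarrow> digamma_gap s < digamma_gap t"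
  unfolding digamma_gap_def using Digamma_real_strict_mono[of "1 + s" "1 + t"] by simp

lemma digamma_gap_root:
  assumes "z < 1"
  obtains r where "-1 < r" "r < 1" "digamma_gap r = z"
proof -
  \<comment> \<open>Multiplying by \<open>1 + s\<close> and shifting the argument of
    \<open>Digamma\<close> removes the pole at -1, so the intermediate value theorem applies on the
    closed interval; \<open>g (-1) = -1\<close>.\<close>
  define g where "g s = (1 + s) * (Digamma (2 + s) - Digamma 1 - z) - 1" for s :: real
  have g: "g s = (1 + s) * (digamma_gap s - z)" if "s > -1" for s
    using Digamma_plus1[of "1 + s"] that by (simp add: g_def digamma_gap_def field_simps)
  have cont: "continuous_on {-1..1} g"
    unfolding g_def by (intro continuous_intros continuous_at_imp_continuous_on ballI isCont_Polygamma)
      (auto intro!: not_nonpos_Ints_pos)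
  have "g (-1) \<le> 0" "0 \<le> g 1"
    using assms Digamma_2_minus_Digamma_1 by (auto simp: g_def[of "-1"] g[of 1] digamma_gap_def)
  then obtain r where r: "-1 \<le> r" "r \<le> 1" "g r = 0"
    using IVT'[of g "-1" 0 1] cont by auto
  have "r \<noteq> -1" using r by (auto simp: g_def)
  then have "r > -1" using r by simp
  then have "digamma_gap r = z" using g[of r] r by simp
  moreover have "r \<noteq> 1" using \<open>digamma_gap r = z\<close> assms Digamma_2_minus_Digamma_1 by (auto simp: digamma_gap_def)
  ultimately show ?thesis using that[of r] \<open>r > -1\<close> r by simp
qed

lemma digamma_gap_inj: "-1 < r \<Longrightarrow> -1 < s \<Longrightarrow> digamma_gap r = digamma_gap s \<Longrightarrow> r = s"
  using digamma_gap_strict_mono[of r s] digamma_gap_strict_mono[of s r] by linarith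

lemma rho_unique: "z < 1 \<Longrightarrow> \<exists>!r. -1 < r \<and> digamma_gap r = z"
  by (metis digamma_gap_root digamma_gap_inj)

lemma rho_eqI: "-1 < r \<Longrightarrow> digamma_gap r = z \<Longrightarrow> rho z = r"
  unfolding rho_def digamma_gap_def[symmetric] by (intro the_equality) (auto intro: digamma_gap_inj)

lemma rho_props:
  assumes "z < 1"
  shows "-1 < rho z" "rho z < 1" "digamma_gap (rho z) = z"
  using digamma_gap_root[OF assms] rho_eqI by metis+

lemma rho_mono: "y \<le> z \<Longrightarrow> z < 1 \<Longrightarrow> rho y \<le> rho z"
  using digamma_gap_strict_mono[of "rho z" "rho y"] rho_props[of z] rho_props[of y] by linarith

lemma Digamma_strict_mono_neg:
  assumes "-1 < s" "s < t" "t < (0::real)"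
  shows "Digamma s < Digamma t"
proof (rule DERIV_pos_imp_increasing[OF assms(2)])
  fix x assume "s \<le> x" "x \<le> t"
  then have "x \<notin> \<int>\<^sub>\<le>\<^sub>0" using assms by (intro not_nonpos_Ints_gt_minus_1) auto
  then show "\<exists>y. (Digamma has_real_derivative y) (at x) \<and> 0 < y"
    by (intro exI[of _ "Polygamma 1 x"] conjI Polygamma_real_odd_pos)
       (auto intro!: derivative_eq_intros)
qed

lemma s1_props:
  shows "-1 < s1 a" "s1 a < 0" "Digamma (s1 a) = a"
proof -
  \<comment> \<open>Two shifts and the factor \<open>s * (s + 1)\<close> clear the poles at both
    ends; \<open>g\<close> is 1 at -1 and -1 at 0.\<close>
  define g where "g s = s * (s + 1) * (Digamma (s + 2) - a) - s - (s + 1)" for s :: real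
  have g: "g s = s * (s + 1) * (Digamma s - a)" if "-1 < s" "s < 0" for s
  proof -
    have "Digamma (s + 2) = Digamma s + (1 / s + 1 / (s + 1))"
      using Digamma_plus1[of s] Digamma_plus1[of "s + 1"] that by (simp add: add.assoc)
    then have "g s = s * (s + 1) * (Digamma s - a) + s * (s + 1) * (1 / s + 1 / (s + 1)) - s - (s + 1)"
      by (simp add: g_def algebra_simps)
    moreover have "s * (s + 1) * (1 / s + 1 / (s + 1)) = s + (s + 1)"
    proof -
      have "s * (s + 1) * (1 / s) = s + 1" "s * (s + 1) * (1 / (s + 1)) = s" using that by simp_all
      then show ?thesis by (simp only: distrib_left)
    qed
    ultimately show ?thesis by simp
  qed
  have cont: "continuous_on {-1..0} g"
    unfolding g_def by (intro continuous_intros continuous_at_imp_continuous_on ballI isCont_Polygamma)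
      (auto intro!: not_nonpos_Ints_pos)
  have "g 0 \<le> 0" "0 \<le> g (-1)" by (simp_all add: g_def)
  then obtain r where r: "-1 \<le> r" "r \<le> 0" "g r = 0"
    using IVT2'[of g 0 0 "-1"] cont by auto
  have "r \<noteq> -1" "r \<noteq> 0" using r(3) by (auto simp: g_def)
  then have r': "-1 < r" "r < 0" using r by auto
  then have "Digamma r = a" using g[of r] r by simp
  then have "\<exists>!s. -1 < s \<and> s < 0 \<and> Digamma s = a"
    using r' by (metis Digamma_strict_mono_neg less_irrefl linorder_neqE_linordered_idom)
  from theI'[OF this] show "-1 < s1 a" "s1 a < 0" "Digamma (s1 a) = a"
    unfolding s1_def by auto
qed

text \<open>Since \<open>1 - sigma_star\<close> is the chosen root of
  \<open>Digamma s = Digamma 2\<close>, the point \<open>- sigma_star\<close> is the root below -1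
  for the boundary value \<open>z = 1\<close>. This is why one exponent serves all
  \<open>z < 1\<close>.\<close>

lemma sigma_star_props: "1 < sigma_star" "sigma_star < 2" "digamma_gap (- sigma_star) = 1"
proof -
  have *: "1 + - sigma_star = s1 (Digamma 2)" using s1_props[of "Digamma 2"] by (simp add: sigma_star_def)
  then show "1 < sigma_star" "sigma_star < 2" using s1_props[of "Digamma 2"] by linarith+
  show "digamma_gap (- sigma_star) = 1" unfolding digamma_gap_def * using s1_props Digamma_2_minus_Digamma_1 by simp
qed

lemma Polygamma_1_pos: "x > 0 \<Longrightarrow> Polygamma 1 (x::real) > 0"
  by (intro Polygamma_real_odd_pos not_nonpos_Ints_pos) auto

section \<open>Closed form and passage to the limit\<close>

lemma mgf_D_0:
  assumes "n \<ge> 1"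
  shows "mgf_D 0 n = 1"
  using prob_space.prob_space[OF prob_space_D_law[OF assms]] by (simp add: mgf_D_def)

lemma mgf_D_closed_form:
  assumes "z < 1" "z \<noteq> 0"
  shows "mgf_D z (Suc N) = (\<Sum>k\<le>N. (-1) ^ k * real (N choose k) * (- z / (harm k - z)))"
  using harmonic_recurrence_solution[of z "\<lambda>k. mgf_D z (Suc k)" N] assms mgf_D_1 mgf_D_recurrence by simp

text \<open>The limit of \<open>gap_trunc_sum_estimate\<close> with the pole held at
  \<open>rho z\<close>: \<open>gap_trunc M (rho z)\<close> tends to \<open>z\<close>,
  \<open>gap_trunc M k\<close> to \<open>harm k\<close>, and the bound's denominator to
  \<open>1 - z\<close>.\<close>

lemma mgf_D_estimate:
  assumes "z < 1" "n \<ge> 2"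
  shows "\<bar>mgf_D z n - Cz z * (Gamma (real n) / Gamma (real n - rho z))\<bar>
      \<le> \<bar>z\<bar> / (1 - z) * ((1 + sigma_star) * beta_coeff sigma_star (n - 1))"
proof (cases "z = 0")
  case True
  \<comment> \<open>Here the main term is exactly 1, as is the moment generating function, so the
    error is zero.\<close>
  have "rho 0 = 0" by (rule rho_eqI) (simp_all add: digamma_gap_def)
  moreover have "Gamma (real n) \<noteq> 0" using Gamma_real_pos[of "real n"] assms by linarith
  moreover have "Polygamma 1 (1::real) > 0" by (rule Polygamma_1_pos) simp
  ultimately show ?thesis using True assms by (simp add: mgf_D_0 Cz_def)
next
  case False
  define r where "r = rho z"
  note r = rho_props[OF assms(1), folded r_def]
  note \<sigma> = sigma_star_props
  obtain N where N: "n = Suc N" "N \<ge> 1" using assms by (cases n) auto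
  have r0: "r \<noteq> 0" using r(3) False by (auto simp: digamma_gap_def)
  have hz: "harm k - z \<noteq> 0" for k
    using harm_ge_1[of k] assms False by (cases "k = 0") (auto simp: harm_def)
  let ?S = "\<lambda>M. (\<Sum>k\<le>N. (-1) ^ k * real (N choose k) / (gap_trunc M k - gap_trunc M r))"
  have phir: "(\<lambda>M. gap_trunc M r) \<longlonglongrightarrow> z" using gap_trunc_LIMSEQ[of r] r by simp
  have lim1: "(\<lambda>M. \<bar>?S M - beta_coeff (- r) N / gap_trunc_deriv M r\<bar>)
      \<longlonglongrightarrow> \<bar>(\<Sum>k\<le>N. (-1) ^ k * real (N choose k) / (harm k - z)) - beta_coeff (- r) N / Polygamma 1 (1 + r)\<bar>"
  proof (intro tendsto_intros phir)
    show "(\<lambda>M. gap_trunc M (real k)) \<longlonglongrightarrow> harm k" for k using gap_trunc_LIMSEQ[of "real k"] by (simp add: digamma_gap_of_nat)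
    show "(\<lambda>M. gap_trunc_deriv M r) \<longlonglongrightarrow> Polygamma 1 (1 + r)" using gap_trunc_deriv_LIMSEQ[of r] r by simp
    show "Polygamma 1 (1 + r) \<noteq> 0" using Polygamma_1_pos[of "1 + r"] r by simp
  qed (rule hz)
  have "digamma_gap 1 = 1" using Digamma_2_minus_Digamma_1 by (simp add: digamma_gap_def)
  then have gap1: "(\<lambda>M. gap_trunc M 1) \<longlonglongrightarrow> 1" using gap_trunc_LIMSEQ[of 1] by simp
  have lim2: "(\<lambda>M. (1 + sigma_star) * beta_coeff sigma_star N / (gap_trunc M 1 - gap_trunc M r))
      \<longlonglongrightarrow> (1 + sigma_star) * beta_coeff sigma_star N / (1 - z)"
    using assms by (intro tendsto_intros phir gap1) auto
  \<comment> \<open>Below 1 the truncated value also lies below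
    \<open>gap_trunc M (- sigma_star)\<close>, which is at least
    \<open>digamma_gap (- sigma_star) = 1\<close>.\<close>
  have "eventually (\<lambda>M. gap_trunc M r < 1) sequentially"
    using order_tendstoD(2)[OF phir, of 1] assms by simp
  then have "eventually (\<lambda>M. \<bar>?S M - beta_coeff (- r) N / gap_trunc_deriv M r\<bar>
      \<le> (1 + sigma_star) * beta_coeff sigma_star N / (gap_trunc M 1 - gap_trunc M r)) sequentially"
    using eventually_ge_at_top[of 2]
  proof eventually_elim
    case (elim M)
    have "gap_trunc M r < gap_trunc M (- sigma_star)" using gap_trunc_ge_digamma_gap[of sigma_star M] \<sigma> elim by simp
    then show ?case using elim r r0 \<sigma> N by (intro gap_trunc_sum_estimate) auto
  qed
  from tendsto_le[OF trivial_limit_sequentially lim2 lim1 this]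
  have *: "\<bar>(\<Sum>k\<le>N. (-1) ^ k * real (N choose k) / (harm k - z)) - beta_coeff (- r) N / Polygamma 1 (1 + r)\<bar>
      \<le> (1 + sigma_star) * beta_coeff sigma_star N / (1 - z)" .
  have "mgf_D z n = - z * (\<Sum>k\<le>N. (-1) ^ k * real (N choose k) / (harm k - z))"
    unfolding N mgf_D_closed_form[OF assms(1) False] sum_distrib_left by (intro sum.cong) auto
  moreover have "Cz z * (Gamma (real n) / Gamma (real n - r)) = - z * (beta_coeff (- r) N / Polygamma 1 (1 + r))"
  proof -
    have "- r \<notin> \<int>\<^sub>\<le>\<^sub>0" using r r0 by (intro not_nonpos_Ints_gt_minus_1) auto
    then have "pochhammer (- r) n = Gamma (real n - r) / Gamma (- r)"
      using pochhammer_Gamma[of "- r" n] by (simp add: add.commute)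
    moreover have "Gamma (real n) = fact N" by (simp add: N Gamma_fact add.commute)
    ultimately show ?thesis using False by (simp add: Cz_def beta_coeff_def N r_def mult_ac)
  qed
  ultimately have "\<bar>mgf_D z n - Cz z * (Gamma (real n) / Gamma (real n - r))\<bar>
      = \<bar>z\<bar> * \<bar>(\<Sum>k\<le>N. (-1) ^ k * real (N choose k) / (harm k - z)) - beta_coeff (- r) N / Polygamma 1 (1 + r)\<bar>"
    by (simp add: abs_mult[symmetric] right_diff_distrib abs_minus_commute)
  also have "\<dots> \<le> \<bar>z\<bar> * ((1 + sigma_star) * beta_coeff sigma_star N / (1 - z))"
    using * by (rule mult_left_mono) simp
  finally show ?thesis by (simp add: N r_def)
qed

section \<open>Bounds for Gamma quotients and for the constant \<open>Cz\<close>\<close>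

lemma Gamma_add_le:
  fixes x s :: real
  assumes "x > 0" "0 \<le> s" "s \<le> 1"
  shows "Gamma (x + s) \<le> x powr s * Gamma x"
proof -
  have G: "Gamma x \<noteq> 0" using Gamma_real_pos[of x] assms by linarith
  \<comment> \<open>Log-convexity between \<open>x\<close> and \<open>x + 1\<close>, over which
    \<open>ln Gamma\<close> grows by \<open>ln x\<close>.\<close>
  have "(ln \<circ> Gamma) ((1 - s) *\<^sub>R x + s *\<^sub>R (x + 1)) \<le> (1 - s) * (ln \<circ> Gamma) x + s * (ln \<circ> Gamma) (x + 1)"
    using assms by (intro convex_onD[OF log_convex_Gamma_real]) auto
  moreover have "(1 - s) *\<^sub>R x + s *\<^sub>R (x + 1) = x + s" by (simp add: algebra_simps)
  moreover have "ln (Gamma (x + 1)) = ln x + ln (Gamma x)"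
    using assms Gamma_plus1[of x] not_nonpos_Ints_pos[of x] G by (simp add: ln_mult)
  ultimately have "ln (Gamma (x + s)) \<le> s * ln x + ln (Gamma x)" by (simp add: algebra_simps)
  also have "\<dots> = ln (x powr s * Gamma x)"
    using assms G by (simp add: ln_mult)
  finally show ?thesis
    using assms Gamma_real_pos[of x] Gamma_real_pos[of "x + s"] by (subst (asm) ln_le_cancel_iff) auto
qed

text \<open>\<open>Gamma_add_le\<close> is used twice, from \<open>x\<close> and from
  \<open>x - r\<close>: once with step \<open>\<bar>r\<bar>\<close> between these two points, and
  once with step \<open>1 - \<bar>r\<bar>\<close> from the larger to one more than the
  smaller.\<close>

lemma Gamma_ratio_estimate:
  fixes r x :: real
  assumes "-1 < r" "r < 1" "x \<ge> 1"
  shows "\<bar>Gamma x / Gamma (x - r) - x powr r\<bar> \<le> x powr r / x"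
proof -
  have G: "Gamma x > 0" "Gamma (x - r) > 0" using assms by (auto intro!: Gamma_real_pos)
  show ?thesis
  proof (cases "r \<le> 0")
    case True
    have "Gamma (x + (- r)) \<le> x powr (- r) * Gamma x" using True assms by (intro Gamma_add_le) auto
    then have lower: "x powr r \<le> Gamma x / Gamma (x - r)"
      using G assms by (simp add: powr_minus field_simps)
    have "x * Gamma x = Gamma (x - r + (1 + r))"
      using Gamma_plus1[of x] not_nonpos_Ints_pos[of x] assms by simp
    also have "\<dots> \<le> (x - r) powr (1 + r) * Gamma (x - r)"
      using True assms by (intro Gamma_add_le) auto
    also have "(x - r) powr (1 + r) = x powr (1 + r) * ((x - r) / x) powr (1 + r)"
      using True assms by (simp add: powr_divide)
    \<comment> \<open>The base is at least 1 and the exponent at most 1; then \<open>r > -1\<close>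
      bounds the base by \<open>1 + 1 / x\<close>.\<close>
    also have "((x - r) / x) powr (1 + r) \<le> ((x - r) / x) powr 1"
      using True assms by (intro powr_mono) auto
    also have "\<dots> \<le> (x + 1) / x" using True assms by (simp add: divide_right_mono)
    also have "\<dots> = 1 + 1 / x" using assms by (simp add: add_divide_distrib)
    also have "x powr (1 + r) = x * x powr r" using assms by (simp add: powr_add)
    finally have "Gamma x \<le> x powr r * (1 + 1 / x) * Gamma (x - r)"
      using assms G by simp
    then have "Gamma x / Gamma (x - r) \<le> x powr r * (1 + 1 / x)"
      using G by (simp add: pos_divide_le_eq)
    with lower show ?thesis by (simp add: algebra_simps)
  next
    case False
    have "Gamma (x - r + r) \<le> (x - r) powr r * Gamma (x - r)"
      using False assms by (intro Gamma_add_le) auto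
    also have "\<dots> \<le> x powr r * Gamma (x - r)"
      using False assms G by (intro mult_right_mono powr_mono2) auto
    finally have upper: "Gamma x / Gamma (x - r) \<le> x powr r"
      using G by (simp add: pos_divide_le_eq)
    have "(x - r) * Gamma (x - r) = Gamma (x + (1 - r))"
      using Gamma_plus1[of "x - r"] not_nonpos_Ints_pos[of "x - r"] assms by (simp add: algebra_simps)
    also have "\<dots> \<le> x powr (1 - r) * Gamma x"
      using False assms by (intro Gamma_add_le) auto
    also have "x powr (1 - r) = x / x powr r" using assms by (simp add: powr_diff)
    finally have "(x - r) * x powr r / x \<le> Gamma x / Gamma (x - r)"
      using G assms by (simp add: field_simps)
    moreover have "x powr r - x powr r / x \<le> (x - r) * x powr r / x"
      using assms by (simp add: field_simps)
    ultimately have "x powr r - x powr r / x \<le> Gamma x / Gamma (x - r)" by linarith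
    with upper show ?thesis by (simp add: abs_le_iff)
  qed
qed

text \<open>On \<open>[1, 2]\<close> the bound follows from \<open>Gamma 2 = 1\<close> through
  \<open>Gamma_add_le\<close>; below 1 the functional equation gives
  \<open>Gamma x \<ge> Gamma (x + 1)\<close>.\<close>

lemma Gamma_ge_half:
  fixes x :: real
  assumes "0 < x" "x \<le> 2"
  shows "Gamma x \<ge> 1 / 2"
proof -
  have ge: "Gamma y \<ge> 1 / 2" if "1 \<le> y" "y \<le> 2" for y :: real
  proof -
    have "Gamma (y + (2 - y)) \<le> y powr (2 - y) * Gamma y" using that by (intro Gamma_add_le) auto
    also have "\<dots> \<le> 2 * Gamma y"
    proof (rule mult_right_mono)
      have "y powr (2 - y) \<le> y powr 1" using that by (intro powr_mono) auto
      then show "y powr (2 - y) \<le> 2" using that by simp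
    qed (use that in \<open>auto intro!: less_imp_le Gamma_real_pos\<close>)
    finally show ?thesis using Gamma_numeral[of "num.Bit0 num.One", where 'a = real] by (simp add: fact_numeral)
  qed
  show ?thesis
  proof (cases "x \<ge> 1")
    case False
    have "Gamma (x + 1) = x * Gamma x" using Gamma_plus1[of x] not_nonpos_Ints_pos assms by simp
    also have "\<dots> \<le> 1 * Gamma x" using False assms by (intro mult_right_mono less_imp_le Gamma_real_pos) auto
    finally show ?thesis using ge[of "x + 1"] False assms by simp
  qed (use ge assms in simp)
qed

text \<open>Mean value theorem from 0: the ratio is a value of the trigamma function at a point
  below 2, and trigamma decreases.\<close>

lemma digamma_gap_ratio_ge:
  assumes "-1 < r" "r < 1" "r \<noteq> 0"
  shows "digamma_gap r / r \<ge> Polygamma 1 2"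
proof -
  have D: "(digamma_gap has_real_derivative Polygamma 1 (1 + x)) (at x)" if "x > -1" for x
    unfolding digamma_gap_def using that by (auto intro!: derivative_eq_intros not_nonpos_Ints_pos)
  have mono: "Polygamma 1 2 \<le> Polygamma 1 (1 + x)" if "-1 < x" "x < 1" for x :: real
    using Polygamma_real_strict_antimono[of "1 + x" 2 1] that by simp
  have digamma_gap0: "digamma_gap 0 = 0" by (simp add: digamma_gap_def)
  show ?thesis
  proof (cases "r > 0")
    case True
    then obtain x where "0 < x" "x < r" "digamma_gap r - digamma_gap 0 = (r - 0) * Polygamma 1 (1 + x)"
      using MVT2[of 0 r digamma_gap "\<lambda>x. Polygamma 1 (1 + x)"] D assms by auto
    then show ?thesis using mono[of x] True assms digamma_gap0 by simp
  next
    case False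
    then obtain x where "r < x" "x < 0" "digamma_gap 0 - digamma_gap r = (0 - r) * Polygamma 1 (1 + x)"
      using MVT2[of r 0 digamma_gap "\<lambda>x. Polygamma 1 (1 + x)"] D assms by auto
    then show ?thesis using mono[of x] False assms digamma_gap0 by simp
  qed
qed

text \<open>A positive bound, uniform down to \<open>a\<close>, that lets an additive error be
  turned into a relative one. The numerator equals
  \<open>digamma_gap (rho z) / rho z * Gamma (1 - rho z)\<close> for nonzero \<open>z\<close>, which
  avoids the singularity at \<open>rho z = 0\<close>.\<close>

lemma Cz_ge:
  assumes "a \<le> z" "z < 1"
  shows "Cz z \<ge> Polygamma 1 2 / 2 / Polygamma 1 (1 + rho a)"
proof -
  note r = rho_props[OF assms(2)]
  have P2: "Polygamma 1 (2::real) > 0" by (rule Polygamma_1_pos) simp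
  have "(if z = 0 then Polygamma 1 1 else - z * Gamma (- rho z)) \<ge> Polygamma 1 2 / 2"
  proof (cases "z = 0")
    case True
    have "Polygamma 1 2 < Polygamma 1 (1::real)" by (rule Polygamma_real_strict_antimono) auto
    then show ?thesis using True P2 by simp
  next
    case False
    then have r0: "rho z \<noteq> 0" using r(3) by (auto simp: digamma_gap_def)
    have "- rho z \<notin> \<int>\<^sub>\<le>\<^sub>0" using r r0 by (intro not_nonpos_Ints_gt_minus_1) auto
    then have "Gamma (1 - rho z) = - rho z * Gamma (- rho z)"
      using Gamma_plus1[of "- rho z"] by simp
    then have "- z * Gamma (- rho z) = (digamma_gap (rho z) / rho z) * Gamma (1 - rho z)"
      using r0 r by simp
    moreover have "(digamma_gap (rho z) / rho z) * Gamma (1 - rho z) \<ge> Polygamma 1 2 * (1 / 2)"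
    proof (intro mult_mono digamma_gap_ratio_ge Gamma_ge_half)
      show "0 \<le> digamma_gap (rho z) / rho z" using digamma_gap_ratio_ge[OF r(1,2) r0] P2 by linarith
    qed (use r r0 in auto)
    ultimately show ?thesis using False by simp
  qed
  moreover have "Polygamma 1 (1 + rho z) \<le> Polygamma 1 (1 + rho a)"
    using rho_mono[OF assms] rho_props(1)[of a] assms Polygamma_real_strict_antimono[of "1 + rho a" "1 + rho z" 1]
    by (cases "rho a = rho z") auto
  moreover have "Polygamma 1 (1 + rho z) > 0" using r by (intro Polygamma_1_pos) auto
  ultimately show ?thesis
    unfolding Cz_def using P2 by (intro frac_le) auto
qed

section \<open>Uniform error bounds\<close>

lemma mgf_D_uniform_estimate:
  assumes "\<delta> > 0"
  shows "\<exists>K\<ge>0. \<forall>z\<le>1 - \<delta>. \<forall>n\<ge>2.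
    \<bar>mgf_D z n - Cz z * (Gamma (real n) / Gamma (real n - rho z))\<bar> \<le> K * real n powr (- sigma_star)"
proof -
  obtain K where K: "\<And>n. n \<ge> 2 \<Longrightarrow> beta_coeff sigma_star (n - 1) \<le> K * real n powr (- sigma_star)"
    using beta_coeff_bigo[of sigma_star] sigma_star_props by auto
  \<comment> \<open>The case \<open>n = 2\<close> of the bound shows that its constant is
    positive.\<close>
  have "0 < beta_coeff sigma_star (2 - 1)" using sigma_star_props by (intro beta_coeff_pos) simp
  also have "\<dots> \<le> K * 2 powr (- sigma_star)" using K[of 2] by simp
  finally have "K > 0" by (simp add: zero_less_mult_iff)
  show ?thesis
  proof (intro exI[of _ "(1 + 1 / \<delta>) * ((1 + sigma_star) * K)"] conjI allI impI)
    fix z :: real and n :: nat assume z: "z \<le> 1 - \<delta>" and n: "n \<ge> 2"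
    \<comment> \<open>The prefactor stays bounded as \<open>z\<close> tends to minus infinity, which
      gives uniformity on the whole half-line.\<close>
    have "\<bar>z\<bar> / (1 - z) \<le> 1 + 1 / \<delta>"
    proof -
      have "\<bar>z\<bar> \<le> (1 - z) + 1" using z assms by simp
      then have "\<bar>z\<bar> / (1 - z) \<le> ((1 - z) + 1) / (1 - z)" using z assms by (intro divide_right_mono) auto
      also have "\<dots> = 1 + 1 / (1 - z)" using z assms by (subst add_divide_distrib) simp
      also have "1 / (1 - z) \<le> 1 / \<delta>" using z assms by (intro divide_left_mono) auto
      finally show ?thesis by simp
    qed
    moreover have "0 \<le> (1 + sigma_star) * beta_coeff sigma_star (n - 1)"
      using sigma_star_props beta_coeff_pos[of sigma_star "n - 1"] by simp
    moreover have "(1 + sigma_star) * beta_coeff sigma_star (n - 1) \<le> (1 + sigma_star) * (K * real n powr (- sigma_star))"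
      using sigma_star_props K[OF n] by (intro mult_left_mono) auto
    ultimately have "\<bar>z\<bar> / (1 - z) * ((1 + sigma_star) * beta_coeff sigma_star (n - 1))
        \<le> (1 + 1 / \<delta>) * ((1 + sigma_star) * (K * real n powr (- sigma_star)))"
      using assms by - (rule mult_mono, auto)
    then show "\<bar>mgf_D z n - Cz z * (Gamma (real n) / Gamma (real n - rho z))\<bar>
        \<le> (1 + 1 / \<delta>) * ((1 + sigma_star) * K) * real n powr (- sigma_star)"
      using mgf_D_estimate[of z n] z n assms by (simp add: mult.assoc)
  qed (use assms \<open>K > 0\<close> sigma_star_props in simp)
qed

lemma mgf_D_compact_estimate:
  assumes "compact S" "S \<subseteq> {..<1}"
  shows "\<exists>K. \<forall>z\<in>S. \<forall>n::nat. n \<ge> 2 \<longrightarrow>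
          \<bar>mgf_D z n - Cz z * real n powr rho z\<bar>
            \<le> K * \<bar>Cz z\<bar> * real n powr rho z * real n powr (- min 1 (sigma_star + rho z))"
proof (cases "S = {}")
  case False
  \<comment> \<open>The maximum \<open>b < 1\<close> supplies \<open>\<delta> = 1 - b\<close> for
    the additive estimate, and the minimum \<open>a\<close> supplies the lower bound
    \<open>c\<close> on \<open>Cz\<close>.\<close>
  obtain b where b: "b \<in> S" "\<And>z. z \<in> S \<Longrightarrow> z \<le> b" using compact_attains_sup[OF assms(1) False] by auto
  obtain a where a: "a \<in> S" "\<And>z. z \<in> S \<Longrightarrow> a \<le> z" using compact_attains_inf[OF assms(1) False] by auto
  have S1: "z < 1" if "z \<in> S" for z using that assms by auto
  obtain K where K: "K \<ge> 0" "\<And>z n. z \<le> b \<Longrightarrow> n \<ge> 2 \<Longrightarrow>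
      \<bar>mgf_D z n - Cz z * (Gamma (real n) / Gamma (real n - rho z))\<bar> \<le> K * real n powr (- sigma_star)"
    using mgf_D_uniform_estimate[of "1 - b"] S1[OF b(1)] by auto
  define c where "c = Polygamma 1 2 / 2 / Polygamma 1 (1 + rho a)"
  have c: "c > 0"
    unfolding c_def using rho_props[OF S1[OF a(1)]] by (intro divide_pos_pos Polygamma_1_pos) auto
  show ?thesis
  \<comment> \<open>\<open>K / c\<close> makes the additive error relative to \<open>Cz z\<close>;
    the 1 accounts for replacing the Gamma quotient by a power.\<close>
  proof (intro exI[of _ "K / c + 1"] ballI allI impI)
    fix z and n :: nat assume z: "z \<in> S" and n: "n \<ge> 2"
    have Cz: "c \<le> Cz z" unfolding c_def using a z S1 by (intro Cz_ge) auto
    define m where "m = min 1 (sigma_star + rho z)"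
    define x where "x = real n powr rho z"
    \<comment> \<open>Relative to the main power the additive error has exponent
      \<open>sigma_star + rho z\<close> and the Gamma quotient error has exponent 1;
      \<open>m\<close> is the smaller of the two.\<close>
    have "real n powr (- sigma_star) = x * real n powr (- (sigma_star + rho z))"
      unfolding x_def by (simp flip: powr_add)
    also have "\<dots> \<le> x * real n powr (- m)"
      unfolding x_def m_def using n by (intro mult_left_mono powr_mono) auto
    finally have p: "real n powr (- sigma_star) \<le> x * real n powr (- m)" .
    have "K * real n powr (- sigma_star) \<le> K / c * Cz z * (x * real n powr (- m))"
    proof (rule mult_mono)
      have "K * c \<le> K * Cz z" using K Cz by (intro mult_left_mono)
      then show "K \<le> K / c * Cz z" using c by (simp add: field_simps)
    qed (use p K c Cz in auto)
    moreover have "\<bar>Gamma (real n) / Gamma (real n - rho z) - x\<bar> \<le> x / real n"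
      unfolding x_def using rho_props[OF S1[OF z]] n by (intro Gamma_ratio_estimate) auto
    moreover have "x / real n \<le> x * real n powr (- m)"
    proof -
      have "real n powr (-1) \<le> real n powr (- m)" unfolding m_def using n by (intro powr_mono) auto
      then show ?thesis using n mult_left_mono[of "real n powr (-1)" "real n powr (- m)" x]
        by (simp add: powr_minus divide_inverse x_def)
    qed
    ultimately have "\<bar>Cz z * (Gamma (real n) / Gamma (real n - rho z) - x)\<bar> \<le> Cz z * (x * real n powr (- m))"
      using c Cz by (auto simp: abs_mult intro!: mult_left_mono)
    moreover have "mgf_D z n - Cz z * x = (mgf_D z n - Cz z * (Gamma (real n) / Gamma (real n - rho z)))
        + Cz z * (Gamma (real n) / Gamma (real n - rho z) - x)"
      by (simp add: algebra_simps)
    ultimately have "\<bar>mgf_D z n - Cz z * x\<bar> \<le> K * real n powr (- sigma_star) + Cz z * (x * real n powr (- m))"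
      using K(2)[OF b(2)[OF z] n] by linarith
    also have "\<dots> \<le> (K / c + 1) * \<bar>Cz z\<bar> * x * real n powr (- m)"
      using \<open>K * real n powr (- sigma_star) \<le> _\<close> c Cz by (simp add: algebra_simps)
    finally show "\<bar>mgf_D z n - Cz z * real n powr rho z\<bar>
        \<le> (K / c + 1) * \<bar>Cz z\<bar> * real n powr rho z * real n powr (- min 1 (sigma_star + rho z))"
      by (simp add: x_def m_def)
  qed
qed simp

theorem theorem13p5:
  shows "(\<forall>z::real. z < 1 \<longrightarrow> (\<exists>!r::real. r > -1 \<and> Digamma (1 + r) - Digamma 1 = z))
    \<and> (\<forall>z::real. z < 1 \<longrightarrow> -1 < rho z \<and> rho z < 1)
    \<and> (\<forall>\<delta>::real. \<delta> > 0 \<longrightarrow> (\<exists>K. \<forall>z::real. z \<le> 1 - \<delta> \<longrightarrow> (\<forall>n::nat. n \<ge> 2 \<longrightarrow>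
          \<bar>mgf_D z n - Cz z * (Gamma (real n) / Gamma (real n - rho z))\<bar>
            \<le> K * real n powr (- sigma_star))))
    \<and> (\<forall>S::real set. compact S \<and> S \<subseteq> {..<1} \<longrightarrow> (\<exists>K. \<forall>z\<in>S. \<forall>n::nat. n \<ge> 2 \<longrightarrow>
          \<bar>mgf_D z n - Cz z * real n powr rho z\<bar>
            \<le> K * \<bar>Cz z\<bar> * real n powr rho z * real n powr (- min 1 (sigma_star + rho z))))"
proof (intro conjI)
  show "\<forall>z::real. z < 1 \<longrightarrow> (\<exists>!r::real. r > -1 \<and> Digamma (1 + r) - Digamma 1 = z)"
    using rho_unique by (auto simp: digamma_gap_def)
  show "\<forall>z::real. z < 1 \<longrightarrow> -1 < rho z \<and> rho z < 1"
    using rho_props by blast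
qed (use mgf_D_uniform_estimate mgf_D_compact_estimate in blast)+

end
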